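(* Let $d\ge2$ and $\varphi\in\mathcal{O}(2/(d+2))$. Then, in the sense of Wasserstein geometry (i.e. with respect to the Wasserstein distance $W_2$ on $\mathcal{P}_2$), the space $\mathcal{G}_\varphi$ is convex and is isometric to the space $\mathcal{G}$ of Gaussian measures on $\mathbb{R}^d$.
   Context: For a (strictly) increasing, positive, continuous function $\varphi$ on $(0,\infty)$, let $\ln_\varphi(t):=\int_1^t \frac{1}{\varphi(s)}ds$ for $t>0$, $l_\varphi:=\inf_{t>0}\ln_\varphi(t)\in[-\infty,0)$, $L_\varphi:=\sup_{t>0}\ln_\varphi(t)\in(0,+\infty]$. The $\varphi$-exponential function is $\exp_\varphi(\tau):=0$ for $\tau\le l_\varphi$, $\exp_\varphi(\tau):=\ln_\varphi^{-1}(\tau)$ for $\tau\in(l_\varphi,L_\varphi)$, and $\exp_\varphi(\tau):=\infty$ for $\tau\ge L_\varphi$. Set $\delta_\varphi:=\inf\{\delta\in\mathbb{R} : \lim_{s\downarrow 0} s^{1+\delta}/\varphi(s) \text{ exists (as a finite limit)}\}$ and $\delta^\varphi:=\inf\{\delta\in\mathbb{R} : \lim_{s\uparrow\infty} s^{1+\delta}/\varphi(s)=\infty\}$. For $a\in\mathbb{R}$, $\mathcal{O}(a)$ is the set of all increasing, positive, continuous functions $\varphi$ on $(0,\infty)$ with $\max\{\delta_\varphi,\delta^\varphi\}<a$. Let $\mathrm{S}(d,\mathbb{R})_+$ be the set of symmetric positive definite $d\times d$ real matrices, $I_d$ the identity matrix, $\mathcal{L}^d$ Lebesgue measure on $\mathbb{R}^d$,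 and for $V\in \mathrm{S}(d,\mathbb{R})_+$ let $|x|_V^2:=\langle x,V^{-1}x\rangle$. For $d\ge2$ and $\varphi\in\mathcal{O}(2/(d+2))$ there exist constants $\lambda_\varphi(I_d)\in(l_\varphi,L_\varphi)$ and $c_\varphi(I_d)>0$ such that, for all $(v,V)\in\mathbb{R}^d\times \mathrm{S}(d,\mathbb{R})_+$, $$g_\varphi(v,V)(x):=\exp_\varphi\big(\lambda_\varphi(I_d)-c_\varphi(I_d)|x-v|_V^2\big)(\det V)^{-1/2}$$ is a probability density on $(\mathbb{R}^d,\mathcal{L}^d)$ with mean $v$ and covariance matrix $V$. These constants are fixed; $G_\varphi(v,V):=g_\varphi(v,V)\mathcal{L}^d$ and $\mathcal{G}_\varphi:=\{G_\varphi(v,V) : (v,V)\in\mathbb{R}^d\times \mathrm{S}(d,\mathbb{R})_+\}$. The space $\mathcal{G}$ consists of the Gaussian measures on $\mathbb{R}^d$ with mean $v\in\mathbb{R}^d$ and covariance matrix $V\in \mathrm{S}(d,\mathbb{R})_+$. $\mathcal{P}_2$ is the set of Borel probability measures on $\mathbb{R}^d$ with finite second moment, and $W_2(\mu,\nu):=\inf_\pi\big(\int_{\mathbb{R}^d\times\mathbb{R}^d}|x-y|^2d\pi(x,y)\big)^{1/2}$, the infimum being over all couplings $\pi$ of $\mu$ and $\nu$. A Wasserstein geodesic is a distance-minimizing curve of constant speed in $(\mathcal{P}_2,W_2)$. A subset of $\mathcal{P}_2$ is convex if any two of its points can be joined by a Wasserstein geodesic contained in the subset. Isometric means there is a bijection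 between the two spaces preserving $W_2$. *)

theory Defs
  imports "HOL-Probability.Probability"
begin

section \<open>Deformed logarithm and exponential\<close>

text \<open>A function on the open half-line is a total function whose values on
  nonpositive arguments are never used.\<close>

text \<open>The oriented interval integral: for \<open>t < 1\<close> it is minus the integral over \<open>(t, 1)\<close>.\<close>

definition ln_phi :: "(real \<Rightarrow> real) \<Rightarrow> real \<Rightarrow> real" where
  "ln_phi \<phi> t = (LBINT s=ereal 1..ereal t. 1 / \<phi> s)"

definition l_phi :: "(real \<Rightarrow> real) \<Rightarrow> ereal" where
  "l_phi \<phi> = (INF t\<in>{0<..}. ereal (ln_phi \<phi> t))"

definition L_phi :: "(real \<Rightarrow> real) \<Rightarrow> ereal" where
  "L_phi \<phi> = (SUP t\<in>{0<..}. ereal (ln_phi \<phi> t))"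

definition exp_phi :: "(real \<Rightarrow> real) \<Rightarrow> real \<Rightarrow> ennreal" where
  "exp_phi \<phi> \<tau> =
     (if ereal \<tau> \<le> l_phi \<phi> then 0
      else if L_phi \<phi> \<le> ereal \<tau> then \<infinity>
      else ennreal (the_inv_into {0<..} (ln_phi \<phi>) \<tau>))"


section \<open>The class of admissible functions\<close>

text \<open>Both infima are taken in the extended reals, so the infimum of the empty set is \<open>\<infinity>\<close>.\<close>

definition delta_low :: "(real \<Rightarrow> real) \<Rightarrow> ereal" where
  "delta_low \<phi> =
     Inf {ereal \<delta> | \<delta>. \<exists>l::real. ((\<lambda>s. s powr (1 + \<delta>) / \<phi> s) \<longlongrightarrow> l) (at_right 0)}"

definition delta_up :: "(real \<Rightarrow> real) \<Rightarrow> ereal" where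
  "delta_up \<phi> =
     Inf {ereal \<delta> | \<delta>. filterlim (\<lambda>s. s powr (1 + \<delta>) / \<phi> s) at_top at_top}"

definition class_O :: "real \<Rightarrow> (real \<Rightarrow> real) set" where
  "class_O a =
     {\<phi>. strict_mono_on {0<..} \<phi> \<and> (\<forall>s>0. 0 < \<phi> s) \<and> continuous_on {0<..} \<phi> \<and>
          max (delta_low \<phi>) (delta_up \<phi>) < ereal a}"


section \<open>Wasserstein geometry\<close>

definition P2 :: "'a::euclidean_space measure set" where
  "P2 = {\<mu>. prob_space \<mu> \<and> sets \<mu> = sets borel \<and> integrable \<mu> (\<lambda>x. (norm x)\<^sup>2)}"

definition couplings ::
  "'a::euclidean_space measure \<Rightarrow> 'a measure \<Rightarrow> ('a \<times> 'a) measure set" where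
  "couplings \<mu> \<nu> =
     {\<pi>. sets \<pi> = sets (borel \<Otimes>\<^sub>M borel) \<and> distr \<pi> borel fst = \<mu> \<and> distr \<pi> borel snd = \<nu>}"

text \<open>Meant for arguments in \<^const>\<open>P2\<close> only: there the set of couplings is nonempty and the
  cost is integrable for every coupling, so neither the integral nor the infimum takes a
  default value.\<close>

definition W2 :: "'a::euclidean_space measure \<Rightarrow> 'a measure \<Rightarrow> real" where
  "W2 \<mu> \<nu> = (INF \<pi>\<in>couplings \<mu> \<nu>. sqrt (\<integral>p. (norm (fst p - snd p))\<^sup>2 \<partial>\<pi>))"

definition W2_geodesic :: "(real \<Rightarrow> 'a::euclidean_space measure) \<Rightarrow> bool" where
  "W2_geodesic \<gamma> \<longleftrightarrow>
     (\<forall>t\<in>{0..1}. \<gamma> t \<in> P2) \<and>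
     (\<forall>s\<in>{0..1}. \<forall>t\<in>{0..1}. W2 (\<gamma> s) (\<gamma> t) = \<bar>s - t\<bar> * W2 (\<gamma> 0) (\<gamma> 1))"

definition W2_convex :: "'a::euclidean_space measure set \<Rightarrow> bool" where
  "W2_convex S \<longleftrightarrow>
     S \<subseteq> P2 \<and>
     (\<forall>\<mu>\<in>S. \<forall>\<nu>\<in>S. \<exists>\<gamma>. W2_geodesic \<gamma> \<and> \<gamma> 0 = \<mu> \<and> \<gamma> 1 = \<nu> \<and> (\<forall>t\<in>{0..1}. \<gamma> t \<in> S))"

definition W2_isometric ::
  "'a::euclidean_space measure set \<Rightarrow> 'a measure set \<Rightarrow> bool" where
  "W2_isometric S T \<longleftrightarrow>
     S \<subseteq> P2 \<and> T \<subseteq> P2 \<and>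
     (\<exists>f. bij_betw f S T \<and> (\<forall>\<mu>\<in>S. \<forall>\<nu>\<in>S. W2 (f \<mu>) (f \<nu>) = W2 \<mu> \<nu>))"


section \<open>The two families of measures\<close>

definition SPD :: "(real^'n^'n) set" where
  "SPD = {V. transpose V = V \<and> (\<forall>x. x \<noteq> 0 \<longrightarrow> 0 < x \<bullet> (V *v x))}"

definition norm_V2 :: "real^'n^'n \<Rightarrow> real^'n \<Rightarrow> real" where
  "norm_V2 V x = x \<bullet> (matrix_inv V *v x)"

definition mean :: "(real^'n) measure \<Rightarrow> real^'n" where
  "mean \<mu> = (\<integral>x. x \<partial>\<mu>)"

definition covariance :: "(real^'n) measure \<Rightarrow> real^'n^'n" where
  "covariance \<mu> = (\<chi> i j. \<integral>x. (x $ i - mean \<mu> $ i) * (x $ j - mean \<mu> $ j) \<partial>\<mu>)"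

text \<open>The density with the constants \<open>\<lambda>\<close> and \<open>c\<close> still as parameters.\<close>

definition g_density ::
  "(real \<Rightarrow> real) \<Rightarrow> real \<Rightarrow> real \<Rightarrow> real^'n \<Rightarrow> real^'n^'n \<Rightarrow> real^'n \<Rightarrow> ennreal" where
  "g_density \<phi> l c v V x =
     exp_phi \<phi> (l - c * norm_V2 V (x - v)) * ennreal (det V powr (- 1 / 2))"

text \<open>Membership in \<^const>\<open>P2\<close> says that the density has total mass 1 and that mean and
  covariance are genuine integrals. The dimension enters through the type argument.\<close>

definition phi_constants :: "'n::finite itself \<Rightarrow> (real \<Rightarrow> real) \<Rightarrow> real \<Rightarrow> real \<Rightarrow> bool" where
  "phi_constants d \<phi> l c \<longleftrightarrow>
     l_phi \<phi> < ereal l \<and> ereal l < L_phi \<phi> \<and> 0 < c \<and>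
     (\<forall>(v::real^'n) V. V \<in> SPD \<longrightarrow>
        g_density \<phi> l c v V \<in> borel_measurable borel \<and>
        density lborel (g_density \<phi> l c v V) \<in> P2 \<and>
        mean (density lborel (g_density \<phi> l c v V)) = v \<and>
        covariance (density lborel (g_density \<phi> l c v V)) = V)"

definition the_phi_constants :: "'n::finite itself \<Rightarrow> (real \<Rightarrow> real) \<Rightarrow> real \<times> real" where
  "the_phi_constants d \<phi> = (SOME p. phi_constants d \<phi> (fst p) (snd p))"

definition g_phi :: "(real \<Rightarrow> real) \<Rightarrow> real^'n \<Rightarrow> real^'n^'n \<Rightarrow> real^'n \<Rightarrow> ennreal" where
  "g_phi \<phi> =
     g_density \<phi> (fst (the_phi_constants TYPE('n) \<phi>)) (snd (the_phi_constants TYPE('n) \<phi>))"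

definition G_phi :: "(real \<Rightarrow> real) \<Rightarrow> (real^'n) measure set" where
  "G_phi \<phi> = {density lborel (g_phi \<phi> v V) | v V. V \<in> SPD}"

definition gaussian_density :: "real^'n \<Rightarrow> real^'n^'n \<Rightarrow> real^'n \<Rightarrow> real" where
  "gaussian_density v V x =
     (2 * pi) powr (- real CARD('n) / 2) * det V powr (- 1 / 2) * exp (- norm_V2 V (x - v) / 2)"

definition gaussians :: "(real^'n) measure set" where
  "gaussians = {density lborel (\<lambda>x. ennreal (gaussian_density v V x)) | v V. V \<in> SPD}"

end

theory Submission
  imports Defs
begin

text \<open>Write \<open>F v V\<close> for the member of an elliptic family with mean \<open>v\<close> and covariance \<open>V\<close>. An affine
  map \<open>x \<mapsto> u + T (x - v)\<close> sends \<open>F v V\<close> to \<open>F u (T V T\<^sup>T)\<close>, and for symmetric positive definite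
  \<open>T\<close> it is the gradient of a convex quadratic, hence optimal by Kantorovich duality. Any \<open>U\<close> is
  \<open>T V T\<close> for such a \<open>T\<close>, so \<open>W2\<close> between two members depends on means and covariances alone
  and is the same for every elliptic family with normalised covariances; in particular it agrees
  with the Gaussian case. Displacement interpolation replaces \<open>T\<close> by \<open>(1 - t) I + t T\<close> and stays
  in the family.

  That the constants exist at all is an intermediate value argument. With
  \<open>A(m) = \<integral>\<^sub>0\<^sup>m (ln_phi m - ln_phi s)\<^sup>p ds\<close> and \<open>B(m)\<close> the same integral with exponent \<open>p + 1\<close>,
  where \<open>p = d / 2\<close>, the layer cake formula turns the two normalisation conditions with
  \<open>\<lambda> = ln_phi m\<close> into a prescribed value of \<open>B / A\<^bsup>1 + 1/p\<^esup>\<close>. This ratio is continuous, unbounded as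
  \<open>m\<close> tends to \<open>0\<close>, and tends to \<open>0\<close> as \<open>m\<close> grows; the bound \<open>2 / (d + 2)\<close> makes \<open>B\<close> finite
  and \<open>A\<close> unbounded.\<close>

section \<open>Symmetric positive definite matrices\<close>

text \<open>\<open>G_phi\<close> is built from constants picked by \<open>SOME\<close>, so nothing
  can be said about it before one admissible pair has been exhibited; afterwards only the
  specification \<open>phi_constants\<close> is used, and the outcome holds for whichever pair was
  picked. The threshold \<open>2 / (d + 2)\<close> equals \<open>1 / (p + 1)\<close>. Membership in
  the class yields some \<delta> below it with \<open>ln_phi \<phi> m - ln_phi \<phi> s \<le> K * s
  powr (- \<delta>)\<close> for 0 < s \<le> m, and \<open>\<delta> * (p + 1) < 1\<close> makes the
  power \<open>p + 1\<close> of this gap integrable at 0. The profile has no closed form. For fixed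
  s, however, the points where the density exceeds s form a ball whose radius depends only on this
  gap and on \<open>c\<close>, so both conditions become one-dimensional integrals in s. Each
  carries a power of \<open>c\<close>, and eliminating \<open>c\<close> leaves a single equation in
  \<open>m\<close>. On the geometric side the delicate point is constant speed between two interior
  times: the map from time s to time t, \<open>A t ** matrix_inv (A s)\<close>, must itself be
  symmetric positive definite.\<close>

lemma inner_transpose_mult_vec:
  fixes A :: "real^'n^'m"
  shows "(transpose A *v x) \<bullet> y = x \<bullet> (A *v y)"
  by (metis dot_lmul_matrix transpose_transpose vector_transpose_matrix)

lemma symmetric_matrix_iff_inner:
  fixes A :: "real^'n^'n"
  shows "transpose A = A \<longleftrightarrow> (\<forall>x y. (A *v x) \<bullet> y = x \<bullet> (A *v y))"
proof
  assume *: "\<forall>x y. (A *v x) \<bullet> y = x \<bullet> (A *v y)"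
  have "(transpose A *v x) \<bullet> y = (A *v x) \<bullet> y" for x y
    unfolding inner_transpose_mult_vec using * by (rule allE) (erule allE, erule sym)
  then have "transpose A *v x = A *v x" for x
    by (metis vector_eq_rdot)
  then show "transpose A = A"
    unfolding matrix_eq by blast
next
  assume *: "transpose A = A"
  have "(A *v x) \<bullet> y = x \<bullet> (A *v y)" for x y
    using inner_transpose_mult_vec[of A x y] unfolding * .
  then show "\<forall>x y. (A *v x) \<bullet> y = x \<bullet> (A *v y)" by blast
qed

lemma SPD_inner: "V \<in> SPD \<Longrightarrow> (V *v x) \<bullet> y = x \<bullet> (V *v y)"
  using symmetric_matrix_iff_inner[of V] by (auto simp: SPD_def)

lemma SPD_pos: "V \<in> SPD \<Longrightarrow> x \<noteq> 0 \<Longrightarrow> 0 < x \<bullet> (V *v x)"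
  by (auto simp: SPD_def)

lemma SPD_transpose: "V \<in> SPD \<Longrightarrow> transpose V = V"
  by (auto simp: SPD_def)

lemma SPD_I:
  fixes V :: "real^'n^'n"
  assumes "\<And>x y. (V *v x) \<bullet> y = x \<bullet> (V *v y)" "\<And>x. x \<noteq> 0 \<Longrightarrow> 0 < x \<bullet> (V *v x)"
  shows "V \<in> SPD"
  using assms symmetric_matrix_iff_inner[of V] by (auto simp: SPD_def)

lemma SPD_invertible:
  fixes V :: "real^'n^'n"
  assumes "V \<in> SPD" shows "invertible V"
proof -
  have "x = 0" if "V *v x = 0" for x
    using SPD_pos[OF assms, of x] that by (cases "x = 0") auto
  then show ?thesis
    by (metis invertible_left_inverse matrix_left_invertible_ker)
qed

lemma invertible_matrix_inv:
  fixes A :: "real^'n^'n"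
  assumes "invertible A"
  shows "A ** matrix_inv A = mat 1" "matrix_inv A ** A = mat 1"
  using someI_ex[OF assms[unfolded invertible_def]] by (simp_all add: matrix_inv_def)

lemmas SPD_matrix_inv_mult = invertible_matrix_inv[OF SPD_invertible]

lemma SPD_matrix_inv_mult_vec:
  fixes V :: "real^'n^'n"
  assumes "V \<in> SPD"
  shows "V *v (matrix_inv V *v x) = x" "matrix_inv V *v (V *v x) = x"
  using SPD_matrix_inv_mult[OF assms] by (simp_all add: matrix_vector_mul_assoc)

lemma SPD_matrix_inv:
  fixes V :: "real^'n^'n"
  assumes "V \<in> SPD" shows "matrix_inv V \<in> SPD"
proof (rule SPD_I)
  note inv = SPD_matrix_inv_mult_vec[OF assms]
  fix x y :: "real^'n"
  show "(matrix_inv V *v x) \<bullet> y = x \<bullet> (matrix_inv V *v y)"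
    using SPD_inner[OF assms, of "matrix_inv V *v x" "matrix_inv V *v y"] by (simp add: inv)
  assume "x \<noteq> 0"
  then have "matrix_inv V *v x \<noteq> 0"
    by (metis inv(1) matrix_vector_mult_0_right)
  from SPD_pos[OF assms this] show "0 < x \<bullet> (matrix_inv V *v x)"
    by (simp add: inv inner_commute)
qed

lemma SPD_congruence:
  fixes V M :: "real^'n^'n"
  assumes "V \<in> SPD" "invertible M"
  shows "M ** V ** transpose M \<in> SPD"
proof (rule SPD_I)
  have *: "((M ** V ** transpose M) *v x) \<bullet> y = (V *v (transpose M *v x)) \<bullet> (transpose M *v y)" for x y
    by (metis inner_transpose_mult_vec matrix_vector_mul_assoc transpose_transpose)
  fix x y :: "real^'n"
  show "((M ** V ** transpose M) *v x) \<bullet> y = x \<bullet> ((M ** V ** transpose M) *v y)"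
    using *[of x y] *[of y x] SPD_inner[OF assms(1)] by (simp add: inner_commute)
  assume "x \<noteq> 0"
  then have "transpose M *v x \<noteq> 0"
    using assms(2) by (metis invertible_def matrix_transpose_mul matrix_vector_mul_assoc
        matrix_vector_mul_lid matrix_vector_mult_0_right transpose_mat)
  from SPD_pos[OF assms(1) this] show "0 < x \<bullet> ((M ** V ** transpose M) *v x)"
    using *[of x x] by (simp add: inner_commute)
qed

lemma SPD_mat_1: "(mat 1 :: real^'n^'n) \<in> SPD"
  by (rule SPD_I) auto

section \<open>Square roots of positive definite matrices\<close>

lemma SPD_coercive:
  fixes V :: "real^'n^'n"
  assumes "V \<in> SPD"
  obtains a where "0 < a" "\<And>x. a * (x \<bullet> x) \<le> x \<bullet> (V *v x)"
proof -
  \<comment> \<open>Compactness of the sphere supplies the constant, in the role of the least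
    eigenvalue, without a spectral decomposition.\<close>
  have "\<exists>x\<in>sphere 0 1. \<forall>y\<in>sphere 0 1. x \<bullet> (V *v x) \<le> y \<bullet> (V *v y)"
    by (rule continuous_attains_inf) (auto intro!: continuous_intros matrix_vector_mult_linear_continuous_on)
  then obtain e where e: "norm e = 1" "\<And>y. norm y = 1 \<Longrightarrow> e \<bullet> (V *v e) \<le> y \<bullet> (V *v y)"
    by auto
  show thesis
  proof (rule that)
    show "0 < e \<bullet> (V *v e)" using SPD_pos[OF assms, of e] e(1) by force
    fix x :: "real^'n"
    show "e \<bullet> (V *v e) * (x \<bullet> x) \<le> x \<bullet> (V *v x)"
    proof (cases "x = 0")
      case False
      have "e \<bullet> (V *v e) \<le> (x /\<^sub>R norm x) \<bullet> (V *v (x /\<^sub>R norm x))"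
        using False by (intro e(2)) auto
      also have "\<dots> = x \<bullet> (V *v x) / (x \<bullet> x)"
        by (simp add: matrix_vector_mult_scaleR divide_simps dot_square_norm power2_eq_square)
      finally show ?thesis using False by (simp add: divide_simps)
    qed auto
  qed
qed

text \<open>Substituting \<open>Y = 1 - X\<close> turns \<open>X\<^sup>2 = 1 - B\<close> into the fixed point equation
  \<open>Y = (B + Y\<^sup>2) / 2\<close>, which is contractive when \<open>\<parallel>B\<parallel> < 1\<close>.\<close>

lemma symmetric_sqrt_fixed_point:
  fixes B :: "'a::euclidean_space \<Rightarrow>\<^sub>L 'a"
  assumes "norm B < 1" "\<And>x y. B x \<bullet> y = x \<bullet> B y"
  obtains Y :: "'a \<Rightarrow>\<^sub>L 'a" where "norm Y < 1" "\<And>x y. Y x \<bullet> y = x \<bullet> Y y"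
    "\<And>x. 2 *\<^sub>R Y x = B x + Y (Y x)"
proof -
  \<comment> \<open>The smaller root of \<open>2 * \<rho> = norm B + \<rho> * \<rho>\<close>, so the
    ball of radius \<rho> is mapped into itself; \<rho> < 1 also serves as the contraction
    factor.\<close>
  define \<rho> where "\<rho> = 1 - sqrt (1 - norm B)"
  have \<rho>: "0 \<le> \<rho>" "\<rho> < 1" "norm B + \<rho>\<^sup>2 = 2 * \<rho>"
    using assms(1) by (auto simp: \<rho>_def power2_eq_square algebra_simps)
  \<comment> \<open>Symmetry is a closed condition preserved by \<open>f\<close>; building it into
    \<open>S\<close> passes it on to the fixed point.\<close>
  define S where "S = {Y :: 'a \<Rightarrow>\<^sub>L 'a. norm Y \<le> \<rho> \<and> (\<forall>x y. blinfun_apply Y x \<bullet> y = x \<bullet> blinfun_apply Y y)}"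
  define f where "f = (\<lambda>Y :: 'a \<Rightarrow>\<^sub>L 'a. (1/2) *\<^sub>R (B + (Y o\<^sub>L Y)))"
  have "closed S"
    unfolding S_def by (intro closed_Collect_conj closed_Collect_all closed_Collect_le
        closed_Collect_eq continuous_intros)
  note complete_eq_closed[THEN iffD2, OF this]
  moreover have "S \<noteq> {}" using \<rho> by (auto simp: S_def intro!: exI[of _ 0])
  moreover have "f Y \<in> S" if "Y \<in> S" for Y
  proof -
    have Y: "norm Y \<le> \<rho>" "\<And>x y. Y x \<bullet> y = x \<bullet> Y y" using that by (auto simp: S_def)
    have "norm (Y o\<^sub>L Y) \<le> \<rho>\<^sup>2"
      using norm_blinfun_compose[of Y Y] mult_mono[OF Y(1) Y(1)] \<rho> by (simp add: power2_eq_square)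
    then have "norm (f Y) \<le> \<rho>"
      using norm_triangle_ineq[of B "Y o\<^sub>L Y"] \<rho> by (simp add: f_def)
    then show ?thesis
      using assms(2) Y(2) by (auto simp: S_def f_def blinfun.bilinear_simps inner_simps)
  qed
  moreover have "dist (f Y) (f Z) \<le> \<rho> * dist Y Z" if "Y \<in> S" "Z \<in> S" for Y Z
  proof -
    have "(Y o\<^sub>L Y) - (Z o\<^sub>L Z) = (Y o\<^sub>L (Y - Z)) + ((Y - Z) o\<^sub>L Z)"
      by (rule blinfun_eqI) (simp add: blinfun.bilinear_simps)
    then have "norm ((Y o\<^sub>L Y) - (Z o\<^sub>L Z)) \<le> norm (Y o\<^sub>L (Y - Z)) + norm ((Y - Z) o\<^sub>L Z)"
      by (metis norm_triangle_ineq)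
    also have "\<dots> \<le> norm Y * norm (Y - Z) + norm (Y - Z) * norm Z"
      by (intro add_mono norm_blinfun_compose)
    also have "\<dots> \<le> \<rho> * norm (Y - Z) + norm (Y - Z) * \<rho>"
      using that by (intro add_mono mult_right_mono mult_left_mono) (auto simp: S_def)
    finally have "norm ((Y o\<^sub>L Y) - (Z o\<^sub>L Z)) \<le> 2 * \<rho> * norm (Y - Z)" by simp
    moreover have "f Y - f Z = (1/2) *\<^sub>R ((Y o\<^sub>L Y) - (Z o\<^sub>L Z))"
      by (simp add: f_def algebra_simps)
    ultimately show ?thesis by (simp add: dist_norm)
  qed
  ultimately obtain Y where Y: "Y \<in> S" "f Y = Y"
    using Banach_fix[of S \<rho> f] \<rho> by blast
  have "2 *\<^sub>R Y = 2 *\<^sub>R f Y" using Y by simp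
  also have "\<dots> = B + (Y o\<^sub>L Y)" by (simp add: f_def)
  finally have "2 *\<^sub>R Y x = B x + Y (Y x)" for x
    by (drule_tac arg_cong[where f = "\<lambda>Z. blinfun_apply Z x"]) (simp add: blinfun.bilinear_simps)
  moreover have "norm Y < 1" "\<And>x y. Y x \<bullet> y = x \<bullet> Y y"
    using Y \<rho> by (auto simp: S_def)
  ultimately show thesis by (rule that[rotated 2])
qed

text \<open>A small multiple \<epsilon> V is close enough to the identity in the sense that
  \<open>1 - \<epsilon> V\<close> has norm below 1. With the fixed point \<open>Y\<close>, the
  operator \<open>1 - Y\<close> squares to \<epsilon> V, and \<open>norm Y < 1\<close> makes it
  positive definite; dividing by \<open>sqrt \<epsilon>\<close> undoes the scaling.\<close>

lemma SPD_sqrt: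
  fixes V :: "real^'n^'n"
  assumes "V \<in> SPD"
  obtains S where "S \<in> SPD" "S ** S = V"
proof -
  obtain a where a: "0 < a" "\<And>x. a * (x \<bullet> x) \<le> x \<bullet> (V *v x)"
    using SPD_coercive[OF assms] by blast
  obtain K where K: "0 < K" "\<And>x. norm (V *v x) \<le> norm x * K"
    using bounded_linear.pos_bounded[OF matrix_vector_mul_bounded_linear[of V]] by blast
  \<comment> \<open>The minimiser of the quadratic bound 1 - 2 \<epsilon> a + \<epsilon>\<epsilon> K
    K obtained below for the squared norm of \<open>B\<close>.\<close>
  define \<epsilon> where "\<epsilon> = a / K\<^sup>2"
  have \<epsilon>: "0 < \<epsilon>" "\<epsilon> * K\<^sup>2 = a" using a K by (auto simp: \<epsilon>_def)
  define B where "B = Blinfun (\<lambda>x. x - \<epsilon> *\<^sub>R (V *v x))"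
  have B: "blinfun_apply B x = x - \<epsilon> *\<^sub>R (V *v x)" for x
    unfolding B_def
    by (subst bounded_linear_Blinfun_apply)
       (auto intro!: bounded_linear_sub bounded_linear_ident bounded_linear_const_scaleR)
  have Bsq: "(norm (B x))\<^sup>2 \<le> (1 - \<epsilon> * a) * (norm x)\<^sup>2" for x
  proof -
    have "(norm (B x))\<^sup>2 = (norm x)\<^sup>2 - 2 * \<epsilon> * (x \<bullet> (V *v x)) + \<epsilon>\<^sup>2 * (norm (V *v x))\<^sup>2"
      unfolding power2_norm_eq_inner B
      by (simp add: inner_diff_left inner_diff_right inner_commute power2_eq_square algebra_simps)
    also have "\<dots> \<le> (norm x)\<^sup>2 - 2 * \<epsilon> * (a * (norm x)\<^sup>2) + \<epsilon>\<^sup>2 * (norm x * K)\<^sup>2"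
      using a(2)[of x] K(2)[of x] \<epsilon>(1)
      by (intro add_mono diff_mono mult_left_mono power_mono) (auto simp: power2_norm_eq_inner)
    also have "\<dots> = (1 - 2 * \<epsilon> * a + \<epsilon> * (\<epsilon> * K\<^sup>2)) * (norm x)\<^sup>2"
      by (simp add: power2_eq_square algebra_simps)
    also have "\<dots> = (1 - \<epsilon> * a) * (norm x)\<^sup>2" by (simp add: \<epsilon> algebra_simps)
    finally show ?thesis .
  qed
  \<comment> \<open>The \<open>max\<close> replaces a proof that \<open>1 - \<epsilon> * a\<close>
    is nonnegative; \<open>r < 1\<close> holds either way.\<close>
  define r where "r = sqrt (max 0 (1 - \<epsilon> * a))"
  have r: "0 \<le> r" "r < 1" using \<epsilon> a by (auto simp: r_def)
  have "norm B \<le> r"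
  proof (rule norm_blinfun_bound)
    show "norm (B x) \<le> r * norm x" for x
    proof (rule power2_le_imp_le)
      have "(1 - \<epsilon> * a) * (norm x)\<^sup>2 \<le> max 0 (1 - \<epsilon> * a) * (norm x)\<^sup>2"
        by (intro mult_right_mono) auto
      then show "(norm (B x))\<^sup>2 \<le> (r * norm x)\<^sup>2"
        using Bsq[of x] by (simp add: r_def power_mult_distrib)
    qed (use r in auto)
  qed (use r in auto)
  then have "norm B < 1" using r by simp
  moreover have "B x \<bullet> y = x \<bullet> B y" for x y
    by (simp add: B inner_simps SPD_inner[OF assms])
  ultimately obtain Y :: "(real^'n) \<Rightarrow>\<^sub>L (real^'n)" where Y: "norm Y < 1" "\<And>x y. Y x \<bullet> y = x \<bullet> Y y"
    "\<And>x. 2 *\<^sub>R Y x = B x + Y (Y x)"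
    using symmetric_sqrt_fixed_point[of B] by blast
  define f where "f = (\<lambda>x. (1 / sqrt \<epsilon>) *\<^sub>R (x - Y x))"
  have lin: "linear f"
    unfolding f_def by (auto intro!: linearI simp: blinfun.bilinear_simps algebra_simps)
  have matrix_f: "matrix f *v x = f x" for x
    using matrix_works[of f] lin by (simp add: linear_matrix_vector_mul_eq)
  have ff: "f (f x) = V *v x" for x
  proof -
    have "Y (Y x) = 2 *\<^sub>R Y x - (x - \<epsilon> *\<^sub>R (V *v x))" using Y(3)[of x] by (simp add: B)
    then have "(x - Y x) - Y (x - Y x) = \<epsilon> *\<^sub>R (V *v x)"
      by (simp add: blinfun.bilinear_simps scaleR_2)
    moreover have "f (f x) = (1 / sqrt \<epsilon> * (1 / sqrt \<epsilon>)) *\<^sub>R ((x - Y x) - Y (x - Y x))"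
      by (simp add: f_def blinfun.bilinear_simps algebra_simps)
    ultimately show ?thesis using \<epsilon> by simp
  qed
  show thesis
  proof
    show "matrix f \<in> SPD"
    proof (rule SPD_I)
      show "(matrix f *v x) \<bullet> y = x \<bullet> (matrix f *v y)" for x y
        unfolding matrix_f using Y(2) by (simp add: f_def inner_simps)
      fix x :: "real^'n" assume "x \<noteq> 0"
      have "x \<bullet> Y x \<le> norm x * norm (Y x)" using Cauchy_Schwarz_ineq2[of x "Y x"] by simp
      also have "\<dots> \<le> norm x * (norm Y * norm x)" by (intro mult_left_mono norm_blinfun) auto
      also have "\<dots> < norm x * (1 * norm x)"
        using \<open>x \<noteq> 0\<close> Y(1) by (intro mult_strict_left_mono mult_strict_right_mono) auto
      finally have "0 < x \<bullet> (x - Y x)" by (simp add: inner_diff_right dot_square_norm power2_eq_square)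
      then show "0 < x \<bullet> (matrix f *v x)"
        unfolding matrix_f using \<epsilon> by (simp add: f_def)
    qed
    show "matrix f ** matrix f = V"
      by (simp add: matrix_eq matrix_vector_mul_assoc[symmetric] matrix_f ff)
  qed
qed

lemma SPD_det_pos:
  fixes V :: "real^'n^'n"
  assumes "V \<in> SPD" shows "0 < det V"
proof -
  obtain S where S: "S \<in> SPD" "S ** S = V" by (rule SPD_sqrt[OF assms])
  have "det S \<noteq> 0" using SPD_invertible[OF S(1)] by (simp add: invertible_det_nz)
  moreover have "det V = det S * det S" by (simp add: S(2)[symmetric] det_mul)
  ultimately show ?thesis by (simp add: zero_less_mult_iff linorder_neq_iff disj_commute)
qed

text \<open>The solution is \<open>T = V\<^sup>-\<^sup>1\<^sup>/\<^sup>2 (V\<^sup>1\<^sup>/\<^sup>2 U V\<^sup>1\<^sup>/\<^sup>2)\<^sup>1\<^sup>/\<^sup>2 V\<^sup>-\<^sup>1\<^sup>/\<^sup>2\<close>.\<close>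

lemma SPD_transport:
  fixes V U :: "real^'n^'n"
  assumes "V \<in> SPD" "U \<in> SPD"
  obtains T where "T \<in> SPD" "T ** V ** T = U"
proof -
  obtain S where S: "S \<in> SPD" "S ** S = V" by (rule SPD_sqrt[OF assms(1)])
  define R where "R = matrix_inv S"
  have R: "R \<in> SPD" unfolding R_def by (rule SPD_matrix_inv[OF S(1)])
  have RS: "R *v (S *v x) = x" "S *v (R *v x) = x" for x
    using SPD_matrix_inv_mult_vec[OF S(1)] by (auto simp: R_def)
  have "S ** U ** S \<in> SPD"
    using SPD_congruence[OF assms(2) SPD_invertible[OF S(1)]] SPD_transpose[OF S(1)] by simp
  then obtain Q where Q: "Q \<in> SPD" "Q ** Q = S ** U ** S" by (rule SPD_sqrt)
  show thesis
  proof
    show "R ** Q ** R \<in> SPD"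
      using SPD_congruence[OF Q(1) SPD_invertible[OF R]] SPD_transpose[OF R] by simp
    have QQ: "Q *v (Q *v x) = S *v (U *v (S *v x))" for x
      using Q(2) by (metis matrix_vector_mul_assoc)
    show "R ** Q ** R ** V ** (R ** Q ** R) = U"
      by (simp add: matrix_eq matrix_vector_mul_assoc[symmetric] S(2)[symmetric] RS QQ)
  qed
qed

section \<open>Lebesgue measure under affine maps\<close>

text \<open>\<open>lborel\<close> is determined by its values on boxes, and the preimage of a box
  under \<open>g\<close> is its image under \<open>h\<close>, so volumes of images settle the claim
  for \<open>g\<close>. The claim for \<open>h\<close> follows by pushing forward once more.\<close>

lemma lborel_distr_volume_preserving:
  fixes h g :: "'a::euclidean_space \<Rightarrow> 'a"
  assumes lin: "linear h" "linear g" and inv: "\<And>x. g (h x) = x" "\<And>x. h (g x) = x"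
    and vol: "\<And>a b. measure lebesgue (h ` cbox a b) = measure lebesgue (cbox a b)"
  shows "distr lborel borel h = lborel" "distr lborel borel g = lborel"
proof -
  have [measurable]: "h \<in> borel_measurable borel" "g \<in> borel_measurable borel"
    using lin by (auto intro!: borel_measurable_continuous_onI linear_continuous_on linear_linear[THEN iffD2])
  show g: "distr lborel borel g = lborel"
  proof (rule lborel_eqI[symmetric])
    fix l u :: 'a assume le: "\<And>b. b \<in> Basis \<Longrightarrow> l \<bullet> b \<le> u \<bullet> b"
    have eq: "g -` box l u = h ` box l u"
      by (auto simp: image_iff inv) (metis inv(2))
    have fin: "h ` box l u \<in> lmeasurable"
      and meas: "measure lebesgue (h ` box l u) = measure lebesgue (box l u)"
      using measure_linear_sufficient[OF lin(1), of "box l u" 1] vol by auto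
    have "h ` box l u \<in> sets borel"
      using measurable_sets_borel[of g borel "box l u"] by (simp add: eq[symmetric])
    then have "emeasure lborel (h ` box l u) = emeasure lebesgue (h ` box l u)" by simp
    also have "\<dots> = ennreal (measure lebesgue (box l u))"
      using fin meas emeasure_eq_measure2[OF fin] by simp
    also have "\<dots> = emeasure lborel (box l u)"
      using emeasure_eq_measure2[of "box l u" lebesgue] by simp
    also have "\<dots> = (\<Prod>b\<in>Basis. (u - l) \<bullet> b)"
      using le by (rule emeasure_lborel_box)
    finally show "emeasure (distr lborel borel g) (box l u) = (\<Prod>b\<in>Basis. (u - l) \<bullet> b)"
      by (simp add: emeasure_distr eq)
  qed simp
  have "distr lborel borel h = distr (distr lborel borel g) borel h" by (simp add: g)
  also have "\<dots> = distr lborel borel (\<lambda>x. x)"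
    by (subst distr_distr) (auto simp: o_def inv)
  also have "\<dots> = lborel" by (rule distr_id2) simp
  finally show "distr lborel borel h = lborel" .
qed

lemma measurable_matrix_vector_mult [measurable]:
  "(*v) (A :: real^'n^'m) \<in> borel_measurable borel"
  by (intro borel_measurable_continuous_onI matrix_vector_mult_linear_continuous_on)

text \<open>Both sides are multiplicative in the matrix, which reduces the formula to elementary
  matrices: diagonal ones rescale coordinates, swaps and shears preserve volume. The induction
  carries \<open>det A \<noteq> 0\<close> as a premise, so the case of a zero row is
  vacuous.\<close>

lemma lborel_linear:
  fixes A :: "real^'n^'n"
  assumes "det A \<noteq> 0"
  shows "lborel = density (distr lborel borel ((*v) A)) (\<lambda>_. ennreal \<bar>det A\<bar>)"
proof -
  have unit: "lborel = density (distr lborel borel ((*v) B)) (\<lambda>_. ennreal \<bar>det B\<bar>)"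
    if "distr lborel borel ((*v) B) = lborel" "\<bar>det B\<bar> = 1" for B :: "real^'n^'n"
    using that by (simp add: density_1)
  have "det A \<noteq> 0 \<longrightarrow> lborel = density (distr lborel borel ((*v) A)) (\<lambda>_. ennreal \<bar>det A\<bar>)"
  proof (induction A rule: induct_matrix_elementary_alt)
    case (1 A B)
    show ?case
    proof
      assume "det (A ** B) \<noteq> 0"
      then have A: "lborel = density (distr lborel borel ((*v) A)) (\<lambda>_. ennreal \<bar>det A\<bar>)"
        and B: "lborel = density (distr lborel borel ((*v) B)) (\<lambda>_. ennreal \<bar>det B\<bar>)"
        using 1 by (auto simp: det_mul)
      have "distr lborel borel ((*v) A) =
          distr (density (distr lborel borel ((*v) B)) (\<lambda>_. ennreal \<bar>det B\<bar>)) borel ((*v) A)"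
        by (subst B) simp
      also have "\<dots> = density (distr (distr lborel borel ((*v) B)) borel ((*v) A)) (\<lambda>_. ennreal \<bar>det B\<bar>)"
        by (subst density_distr) auto
      also have "distr (distr lborel borel ((*v) B)) borel ((*v) A) = distr lborel borel ((*v) (A ** B))"
        by (subst distr_distr) (auto simp: o_def matrix_vector_mul_assoc)
      finally show "lborel = density (distr lborel borel ((*v) (A ** B))) (\<lambda>_. ennreal \<bar>det (A ** B)\<bar>)"
        by (subst A) (simp add: density_density_eq det_mul abs_mult ennreal_mult mult.commute)
    qed
  next
    case (2 A i)
    then show ?case by (simp add: det_zero_row)
  next
    case (3 A)
    show ?case
    proof
      assume "det A \<noteq> 0"
      then have nz: "A $ i $ i \<noteq> 0" for i using det_diagonal[of A] 3 by auto
      have Ax: "(A *v x) $ i = A $ i $ i * x $ i" for x i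
      proof -
        have "(\<Sum>j\<in>UNIV. A $ i $ j * x $ j) = (\<Sum>j\<in>UNIV. if j = i then A $ i $ i * x $ i else 0)"
          using 3 by (intro sum.cong) auto
        then show ?thesis by (simp add: matrix_vector_mult_def)
      qed
      \<comment> \<open>The diagonal as a function of basis vectors, the form in which
        \<open>lborel_affine_euclidean\<close> takes its scaling factors.\<close>
      define c where "c = (\<lambda>j. j \<bullet> (A *v j))"
      have ca: "c (axis i 1) = A $ i $ i" for i
        by (simp add: c_def inner_axis' Ax)
      have B: "Basis = range (\<lambda>i::'n. axis i (1::real))" by (auto simp: Basis_vec_def)
      have inj: "inj (\<lambda>i::'n. axis i (1::real))" by (simp add: inj_on_def axis_eq_axis)
      have T: "(\<lambda>x. 0 + (\<Sum>j\<in>Basis. (c j * (x \<bullet> j)) *\<^sub>R j)) = (*v) A"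
      proof (rule ext)
        fix x :: "real^'n"
        have "(\<Sum>j\<in>Basis. (c j * (x \<bullet> j)) *\<^sub>R j) = (\<Sum>i\<in>UNIV. (A $ i $ i * x $ i) *\<^sub>R axis i 1)"
          unfolding B by (subst sum.reindex[OF inj]) (simp add: ca inner_axis)
        then show "0 + (\<Sum>j\<in>Basis. (c j * (x \<bullet> j)) *\<^sub>R j) = A *v x"
          by (simp add: vec_eq_iff Ax axis_def if_distrib cong: if_cong)
      qed
      have "(\<Prod>j\<in>Basis. \<bar>c j\<bar>) = \<bar>det A\<bar>"
        unfolding B using det_diagonal[of A] 3
        by (subst prod.reindex[OF inj]) (simp add: ca abs_prod)
      moreover have "c j \<noteq> 0" if "j \<in> Basis" for j using that nz by (auto simp: B ca)
      ultimately show "lborel = density (distr lborel borel ((*v) A)) (\<lambda>_. ennreal \<bar>det A\<bar>)"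
        using lborel_affine_euclidean[of c 0] unfolding T by simp
    qed
  next
    case (4 m n)
    let ?h = "\<lambda>v::real^'n. \<chi> i. v $ Transposition.transpose m n i"
    let ?A = "(\<chi> i j. mat 1 $ i $ Transposition.transpose m n j) :: real^'n^'n"
    have h: "(*v) ?A = ?h"
    proof (rule ext)
      fix x :: "real^'n"
      have "(\<Sum>j\<in>UNIV. (if i = Transposition.transpose m n j then 1 else 0) * x $ j) =
          (\<Sum>j\<in>UNIV. if j = Transposition.transpose m n i then x $ j else 0)" for i
        by (intro sum.cong) auto
      then show "?A *v x = ?h x" by (simp add: vec_eq_iff matrix_vector_mult_def mat_def)
    qed
    have lin: "linear ?h" unfolding h[symmetric] by simp
    have "distr lborel borel ?h = lborel"
    proof (rule lborel_distr_volume_preserving(1)[OF lin lin])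
      fix a b :: "real^'n"
      have "?h ` cbox a b = cbox (?h a) (?h b)"
      proof (intro set_eqI iffI)
        fix x assume "x \<in> cbox (?h a) (?h b)"
        then have "?h x \<in> cbox a b"
          by (simp add: mem_box_cart) (metis transpose_involutory)
        moreover have "x = ?h (?h x)" by (simp add: vec_eq_iff)
        ultimately show "x \<in> ?h ` cbox a b" by blast
      qed (auto simp: mem_box_cart)
      moreover have "(\<Prod>i\<in>UNIV. (?h b - ?h a) $ i) = (\<Prod>i\<in>UNIV. (b - a) $ i)"
        using prod.permute[OF permutes_swap_id, of m UNIV n "\<lambda>i. (b - a) $ i"] by (simp add: o_def)
      moreover have "cbox (?h a) (?h b) = {} \<longleftrightarrow> cbox a b = {}"
        using calculation(1) by (metis image_is_empty)
      ultimately show "measure lebesgue (?h ` cbox a b) = measure lebesgue (cbox a b)"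
        by (cases "cbox a b = {}") (auto simp: content_cbox_cart)
    qed (simp_all add: vec_eq_iff)
    moreover have "\<bar>det ?A\<bar> = 1"
      by (simp add: det_permute_columns permutes_swap_id sign_swap_id abs_mult)
    ultimately show ?case using unit[of ?A] by (simp add: h)
  next
    case (5 m n)
    let ?h = "\<lambda>x::real^'n. \<chi> i. if i = m then x $ m + x $ n else x $ i"
    let ?g = "\<lambda>x::real^'n. \<chi> i. if i = m then x $ m - x $ n else x $ i"
    let ?A = "(\<chi> i j. of_bool (i = m \<and> j = n \<or> i = j)) :: real^'n^'n"
    have h: "(*v) ?A = ?h"
    proof (rule ext)
      fix x :: "real^'n"
      have "(?A *v x) $ i = (\<Sum>j\<in>UNIV. (if j = i then x $ j else 0) + (if j = n then if i = m then x $ n else 0 else 0))" for i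
        unfolding matrix_vector_mult_def using 5 by (auto intro!: sum.cong)
      then show "?A *v x = ?h x" by (simp add: vec_eq_iff sum.distrib)
    qed
    have lin: "linear ?h" "linear ?g"
      by (rule linearI; auto simp: vec_eq_iff algebra_simps)+
    have "distr lborel borel ?h = lborel"
    proof (rule lborel_distr_volume_preserving(1)[OF lin])
      fix a b :: "real^'n"
      show "measure lebesgue (?h ` cbox a b) = measure lebesgue (cbox a b)"
      proof (cases "cbox a b = {}")
        case False
        \<comment> \<open>Moving the lower corner to the origin meets the sign condition of
          \<open>measure_shear_interval\<close>.\<close>
        have "?h ` cbox a b = ?h ` ((+) a ` cbox 0 (b - a))"
          using cbox_translation[of a 0 "b - a"] by simp
        also have "\<dots> = (+) (?h a) ` (?h ` cbox 0 (b - a))"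
          by (simp add: image_image linear_add[OF lin(1)])
        finally have "measure lebesgue (?h ` cbox a b) = measure lebesgue (?h ` cbox 0 (b - a))"
          by (simp only: measure_translation)
        also have "\<dots> = measure lebesgue (cbox 0 (b - a))"
          using False 5 by (intro measure_shear_interval) (auto simp: interval_ne_empty_cart)
        also have "\<dots> = measure lebesgue ((+) a ` cbox 0 (b - a))"
          by (simp only: measure_translation)
        also have "(+) a ` cbox 0 (b - a) = cbox a b"
          using cbox_translation[of a 0 "b - a"] by simp
        finally show ?thesis .
      qed simp
    qed (use 5 in \<open>simp_all add: vec_eq_iff\<close>)
    moreover have "det ?A = 1"
    proof -
      have "?A = (\<chi> k. if k = m then row m (mat 1) + 1 *s row n (mat 1) else row k (mat 1))"
        using 5 by (simp add: vec_eq_iff row_def mat_def)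
      then show ?thesis using det_row_operation[OF 5, of "mat 1" 1] by simp
    qed
    ultimately show ?case by (intro impI unit) (simp_all only: h abs_one)
  qed
  with assms show ?thesis by blast
qed

lemma distr_density_affine:
  fixes A :: "real^'n^'n" and u v :: "real^'n"
  assumes A: "invertible A" and f[measurable]: "f \<in> borel_measurable borel"
  shows "distr (density lborel f) borel (\<lambda>x. u + A *v (x - v)) =
    density lborel (\<lambda>y. f (v + matrix_inv A *v (y - u)) * ennreal (inverse \<bar>det A\<bar>))"
proof -
  have det: "det A \<noteq> 0" using A by (simp add: invertible_det_nz)
  have inv: "A *v (matrix_inv A *v x) = x" "matrix_inv A *v (A *v x) = x" for x
    using invertible_matrix_inv[OF A] by (simp_all add: matrix_vector_mul_assoc)
  define T where "T = (\<lambda>x. u + A *v (x - v))"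
  define T' where "T' = (\<lambda>y. v + matrix_inv A *v (y - u))"
  have mT[measurable]: "T \<in> borel_measurable borel" "T' \<in> borel_measurable borel"
    by (simp_all add: T_def T'_def)
  have T'T: "T' (T x) = x" for x by (simp add: T_def T'_def inv)
  have "distr lborel borel ((*v) A) = density (density (distr lborel borel ((*v) A)) (\<lambda>_. ennreal \<bar>det A\<bar>))
      (\<lambda>_. ennreal (inverse \<bar>det A\<bar>))"
    using det by (simp add: density_density_eq ennreal_mult[symmetric] density_1)
  then have lin: "distr lborel borel ((*v) A) = density lborel (\<lambda>_. ennreal (inverse \<bar>det A\<bar>))"
    using lborel_linear[OF det] by simp
  have shift: "distr lborel borel (\<lambda>x. w + x) = (lborel :: (real^'n) measure)" for w
    using lborel_distr_plus[of w] by simp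
  have "distr lborel borel (\<lambda>x. x - v) = (lborel :: (real^'n) measure)"
    using shift[of "- v"] by simp
  note shift = shift this
  have "distr lborel borel T = distr (distr (distr lborel borel (\<lambda>x. - v + x)) borel ((*v) A)) borel (\<lambda>x. u + x)"
    by (simp add: distr_distr o_def T_def)
  also have "\<dots> = distr (density lborel (\<lambda>_. ennreal (inverse \<bar>det A\<bar>))) borel (\<lambda>x. u + x)"
    by (simp add: shift lin)
  also have "\<dots> = density (distr lborel borel (\<lambda>x. u + x)) (\<lambda>_. ennreal (inverse \<bar>det A\<bar>))"
    by (subst density_distr) auto
  finally have T: "distr lborel borel T = density lborel (\<lambda>_. ennreal (inverse \<bar>det A\<bar>))"
    by (simp add: shift)
  \<comment> \<open>Writing \<open>f\<close> as a function of \<open>T x\<close> lets the density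
    pass through the push-forward.\<close>
  have "distr (density lborel f) borel T = distr (density lborel (\<lambda>x. f (T' (T x)))) borel T"
    by (simp add: T'T)
  also have "\<dots> = density (distr lborel borel T) (\<lambda>y. f (T' y))"
    by (subst density_distr) auto
  also have "\<dots> = density lborel (\<lambda>y. f (T' y) * ennreal (inverse \<bar>det A\<bar>))"
    by (simp add: T density_density_eq mult.commute)
  finally show ?thesis by (simp add: T_def T'_def)
qed

section \<open>Moments and elliptic families\<close>

lemma P2D:
  assumes "\<mu> \<in> P2"
  shows "prob_space \<mu>" "sets \<mu> = sets borel" "integrable \<mu> (\<lambda>x. (norm x)\<^sup>2)"
  using assms by (auto simp: P2_def)

lemma P2_measurable: "\<mu> \<in> P2 \<Longrightarrow> measurable \<mu> N = measurable borel N"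
  by (rule measurable_cong_sets) (simp_all add: P2D)

lemma P2_integrable_const: "\<mu> \<in> P2 \<Longrightarrow> integrable \<mu> (\<lambda>x. c :: 'b::{banach, second_countable_topology})"
  by (simp add: P2_def prob_space.finite_measure finite_measure.integrable_const)

lemma P2_integrable_quadratic_growth:
  fixes f :: "'a::euclidean_space \<Rightarrow> 'b::{banach, second_countable_topology}"
  assumes "\<mu> \<in> P2" "f \<in> borel_measurable borel" "\<And>x. norm (f x) \<le> a + b * (norm x)\<^sup>2"
  shows "integrable \<mu> f"
proof (rule Bochner_Integration.integrable_bound)
  show "integrable \<mu> (\<lambda>x. a + b * (norm x)\<^sup>2)"
    using P2_integrable_const[OF assms(1), of a] P2D(3)[OF assms(1)] by simp
  show "AE x in \<mu>. norm (f x) \<le> norm (a + b * (norm x)\<^sup>2)"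
    using assms(3) by (auto intro: order_trans[OF _ abs_ge_self])
qed (simp add: P2_measurable[OF assms(1)] assms(2))

lemma P2_integrable_id:
  assumes "\<mu> \<in> P2" shows "integrable \<mu> (\<lambda>x::'a::euclidean_space. x)"
proof (rule P2_integrable_quadratic_growth[OF assms, of _ 1 1])
  fix x :: 'a
  have "2 * norm x \<le> 1 + (norm x)\<^sup>2" using sum_squares_bound[of 1 "norm x"] by simp
  then show "norm x \<le> 1 + 1 * (norm x)\<^sup>2" using norm_ge_zero[of x] by linarith
qed simp

lemma P2_integrable_inner_mult:
  fixes a b :: "'a::euclidean_space"
  assumes "\<mu> \<in> P2" shows "integrable \<mu> (\<lambda>x. (x \<bullet> a) * (x \<bullet> b))"
proof (rule P2_integrable_quadratic_growth[OF assms, of _ 0 "norm a * norm b"])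
  fix x :: 'a
  have "\<bar>x \<bullet> a\<bar> * \<bar>x \<bullet> b\<bar> \<le> (norm x * norm a) * (norm x * norm b)"
    by (intro mult_mono Cauchy_Schwarz_ineq2) auto
  then show "norm ((x \<bullet> a) * (x \<bullet> b)) \<le> 0 + norm a * norm b * (norm x)\<^sup>2"
    by (simp add: abs_mult power2_eq_square mult_ac)
qed simp

text \<open>\<open>M\<close> may be singular. This matters because the displacement matrix
  \<open>T - mat 1\<close> of a transport map takes this role later.\<close>

lemma P2_distr_affine:
  fixes \<mu> :: "(real^'n) measure" and M :: "real^'n^'n"
  assumes "\<mu> \<in> P2"
  shows "distr \<mu> borel (\<lambda>x. u + M *v (x - c)) \<in> P2"
proof -
  have [measurable]: "(\<lambda>x. u + M *v (x - c)) \<in> measurable \<mu> borel"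
    unfolding P2_measurable[OF assms] by simp
  obtain K where K: "0 < K" "\<And>x. norm (M *v x) \<le> norm x * K"
    using bounded_linear.pos_bounded[OF matrix_vector_mul_bounded_linear[of M]] by blast
  define w where "w = u - M *v c"
  have "integrable \<mu> (\<lambda>x. (norm (w + M *v x))\<^sup>2)"
  proof (rule P2_integrable_quadratic_growth[OF assms, of _ "2 * (norm w)\<^sup>2" "2 * K\<^sup>2"])
    fix x
    have "norm (w + M *v x) \<le> norm w + norm x * K"
      using norm_triangle_ineq[of w "M *v x"] K(2)[of x] by linarith
    then have "(norm (w + M *v x))\<^sup>2 \<le> (norm w + norm x * K)\<^sup>2" by (intro power_mono) auto
    also have "\<dots> \<le> 2 * (norm w)\<^sup>2 + 2 * K\<^sup>2 * (norm x)\<^sup>2"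
      using sum_squares_bound[of "norm w" "norm x * K"]
      by (simp add: power2_sum power_mult_distrib mult_ac)
    finally show "norm ((norm (w + M *v x))\<^sup>2) \<le> 2 * (norm w)\<^sup>2 + 2 * K\<^sup>2 * (norm x)\<^sup>2" by simp
  qed simp
  moreover have "w + M *v x = u + M *v (x - c)" for x
    by (simp add: w_def matrix_vector_mult_diff_distrib)
  ultimately show ?thesis
    using P2D[OF assms] by (auto simp: P2_def integrable_distr_eq intro: prob_space.prob_space_distr)
qed

lemma P2_integrable_affine:
  fixes \<mu> :: "(real^'n) measure" and M :: "real^'n^'n"
  assumes "\<mu> \<in> P2"
  shows "integrable \<mu> (\<lambda>x. u + M *v (x - c))"
  using P2_integrable_id[OF P2_distr_affine[OF assms, of u M c]]
  by (subst (asm) integrable_distr_eq) (auto simp: P2_measurable[OF assms])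

lemma mean_distr_affine:
  fixes \<mu> :: "(real^'n) measure" and M :: "real^'n^'n"
  assumes "\<mu> \<in> P2"
  shows "mean (distr \<mu> borel (\<lambda>x. u + M *v (x - c))) = u + M *v (mean \<mu> - c)"
proof -
  interpret prob_space \<mu> by (rule P2D[OF assms])
  have "mean (distr \<mu> borel (\<lambda>x. u + M *v (x - c))) = (\<integral>x. u + M *v (x - c) \<partial>\<mu>)"
    unfolding mean_def by (subst integral_distr) (auto simp: P2_measurable[OF assms])
  also have "\<dots> = (\<integral>x. (u - M *v c) + M *v x \<partial>\<mu>)"
    by (simp add: matrix_vector_mult_diff_distrib algebra_simps)
  also have "\<dots> = (u - M *v c) + (\<integral>x. M *v x \<partial>\<mu>)"
    using P2_integrable_affine[OF assms, of 0 M 0] by (subst Bochner_Integration.integral_add) (auto simp: prob_space)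
  also have "(\<integral>x. M *v x \<partial>\<mu>) = M *v mean \<mu>"
    unfolding mean_def
    by (rule integral_bounded_linear[OF matrix_vector_mul_bounded_linear P2_integrable_id[OF assms]])
  finally show ?thesis by (simp add: matrix_vector_mult_diff_distrib algebra_simps)
qed

lemma P2_integrable_centered_mult:
  fixes \<mu> :: "(real^'n) measure"
  assumes "\<mu> \<in> P2"
  shows "integrable \<mu> (\<lambda>x. (x - c) $ i * (x - c) $ j)"
proof -
  have "integrable (distr \<mu> borel (\<lambda>x. 0 + mat 1 *v (x - c))) (\<lambda>x. (x \<bullet> axis i 1) * (x \<bullet> axis j 1))"
    by (intro P2_integrable_inner_mult P2_distr_affine assms)
  then show ?thesis
    by (subst (asm) integrable_distr_eq) (auto simp: P2_measurable[OF assms] inner_axis)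
qed

lemma covariance_distr_affine:
  fixes \<mu> :: "(real^'n) measure" and M :: "real^'n^'n"
  assumes "\<mu> \<in> P2"
  shows "covariance (distr \<mu> borel (\<lambda>x. u + M *v (x - c))) = M ** covariance \<mu> ** transpose M"
proof -
  define m where "m = mean \<mu>"
  have diff: "u + M *v (x - c) - (u + M *v (m - c)) = M *v (x - m)" for x
    by (simp add: matrix_vector_mult_diff_distrib)
  have "covariance (distr \<mu> borel (\<lambda>x. u + M *v (x - c))) $ i $ j = (M ** covariance \<mu> ** transpose M) $ i $ j" for i j
  proof -
    have "covariance (distr \<mu> borel (\<lambda>x. u + M *v (x - c))) $ i $ j =
        (\<integral>x. (u + M *v (x - c) - (u + M *v (m - c))) $ i * (u + M *v (x - c) - (u + M *v (m - c))) $ j \<partial>\<mu>)"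
      unfolding covariance_def mean_distr_affine[OF assms] m_def
      by (simp, subst integral_distr) (auto simp: P2_measurable[OF assms])
    also have "\<dots> = (\<integral>x. (\<Sum>k\<in>UNIV. \<Sum>l\<in>UNIV. (M $ i $ k * M $ j $ l) * ((x - m) $ k * (x - m) $ l)) \<partial>\<mu>)"
      unfolding diff
      by (simp add: matrix_vector_mult_def sum_product mult_ac)
    also have "\<dots> = (\<Sum>k\<in>UNIV. \<Sum>l\<in>UNIV. (M $ i $ k * M $ j $ l) * (\<integral>x. (x - m) $ k * (x - m) $ l \<partial>\<mu>))"
      using P2_integrable_centered_mult[OF assms, of m]
      by (simp add: Bochner_Integration.integral_sum)
    also have "\<dots> = (M ** covariance \<mu> ** transpose M) $ i $ j"
      by (subst sum.swap) (simp add: matrix_matrix_mult_def covariance_def transpose_def m_def sum_distrib_left mult_ac)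
    finally show ?thesis .
  qed
  then show ?thesis by (simp add: vec_eq_iff)
qed

text \<open>The bias-variance identity, coordinate by coordinate. It evaluates transport costs from
  the mean and covariance of the displacement, and it fixes the trace of the covariance of a radial
  law.\<close>

lemma integral_norm_square:
  fixes \<mu> :: "(real^'n) measure"
  assumes "\<mu> \<in> P2"
  shows "(\<integral>x. (norm x)\<^sup>2 \<partial>\<mu>) = (norm (mean \<mu>))\<^sup>2 + trace (covariance \<mu>)"
proof -
  interpret prob_space \<mu> by (rule P2D[OF assms])
  define m where "m = mean \<mu>"
  have int: "integrable \<mu> (\<lambda>x. x $ i)" for i
    using integrable_bounded_linear[OF bounded_linear_vec_nth P2_integrable_id[OF assms]] .
  have mi: "(\<integral>x. x $ i \<partial>\<mu>) = m $ i" for i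
    unfolding m_def mean_def
    by (rule integral_bounded_linear[OF bounded_linear_vec_nth P2_integrable_id[OF assms]])
  have "(\<integral>x. (norm x)\<^sup>2 \<partial>\<mu>) = (\<integral>x. (\<Sum>i\<in>UNIV. (x - m) $ i * (x - m) $ i + (2 * m $ i * x $ i - m $ i * m $ i)) \<partial>\<mu>)"
    by (intro Bochner_Integration.integral_cong refl)
       (simp add: power2_norm_eq_inner inner_vec_def algebra_simps)
  also have "\<dots> = (\<Sum>i\<in>UNIV. (\<integral>x. (x - m) $ i * (x - m) $ i \<partial>\<mu>) + (2 * m $ i * m $ i - m $ i * m $ i))"
    using P2_integrable_centered_mult[OF assms, of m] int
    by (subst Bochner_Integration.integral_sum) (auto simp: mi prob_space simp del: vector_minus_component)
  also have "\<dots> = (norm m)\<^sup>2 + trace (covariance \<mu>)"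
    by (simp add: sum.distrib trace_def covariance_def m_def power2_norm_eq_inner inner_vec_def)
  finally show ?thesis by (simp add: m_def)
qed

text \<open>All normalising constants sit in the profile \<psi>, a function of the squared norm; the
  determinant factor is only the Jacobian. Values in \<open>ennreal\<close> allow for the infinite
  values of \<open>exp_phi\<close>.\<close>

definition elliptic :: "(real \<Rightarrow> ennreal) \<Rightarrow> real^'n \<Rightarrow> real^'n^'n \<Rightarrow> (real^'n) measure" where
  "elliptic \<psi> v V = density lborel (\<lambda>x. \<psi> (norm_V2 V (x - v)) * ennreal (det V powr (- 1 / 2)))"

lemma measurable_norm_V2 [measurable]: "norm_V2 V \<in> borel_measurable borel"
  unfolding norm_V2_def[abs_def] by measurable

lemma distr_elliptic:
  fixes V M :: "real^'n^'n"
  assumes [measurable]: "\<psi> \<in> borel_measurable borel" and V: "V \<in> SPD" and M: "invertible M"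
  shows "distr (elliptic \<psi> v V) borel (\<lambda>x. u + M *v (x - v)) = elliptic \<psi> u (M ** V ** transpose M)"
proof -
  define U where "U = M ** V ** transpose M"
  have U: "U \<in> SPD" unfolding U_def by (rule SPD_congruence[OF V M])
  have inv: "M *v (matrix_inv M *v x) = x" for x
    using invertible_matrix_inv[OF M] by (simp add: matrix_vector_mul_assoc)
  have norm: "norm_V2 V (matrix_inv M *v z) = norm_V2 U z" for z
  proof -
    \<comment> \<open>With z = U w one has
      \<open>matrix_inv M *v z = V *v (transpose M *v w)\<close>, and both quadratic forms become
      the inner product of w and z.\<close>
    define w where "w = matrix_inv U *v z"
    have "M *v (V *v (transpose M *v w)) = z"
      using SPD_matrix_inv_mult_vec(1)[OF U, of z] by (simp add: U_def w_def matrix_vector_mul_assoc matrix_mul_assoc)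
    then have "matrix_inv M *v z = V *v (transpose M *v w)"
      using inv by (metis M invertible_def matrix_vector_mul_assoc matrix_vector_mul_lid)
    then have "norm_V2 V (matrix_inv M *v z) = (matrix_inv M *v z) \<bullet> (transpose M *v w)"
      using SPD_matrix_inv_mult_vec(2)[OF V] by (simp add: norm_V2_def)
    also have "\<dots> = (transpose M *v w) \<bullet> (matrix_inv M *v z)" by (rule inner_commute)
    also have "\<dots> = w \<bullet> z" unfolding inner_transpose_mult_vec inv ..
    finally show ?thesis by (simp add: norm_V2_def w_def inner_commute)
  qed
  have "det U = (det M)\<^sup>2 * det V"
    by (simp add: U_def det_mul det_transpose power2_eq_square)
  moreover have "((det M)\<^sup>2) powr (- 1 / 2) = inverse \<bar>det M\<bar>"
    using M by (simp add: powr_minus powr_half_sqrt invertible_det_nz)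
  ultimately have "det U powr (- 1 / 2) = det V powr (- 1 / 2) * inverse \<bar>det M\<bar>"
    using SPD_det_pos[OF V] by (simp add: powr_mult mult.commute)
  then have "ennreal (det V powr (- 1 / 2)) * ennreal (inverse \<bar>det M\<bar>) = ennreal (det U powr (- 1 / 2))"
    by (simp add: ennreal_mult')
  then show ?thesis
    unfolding elliptic_def U_def[symmetric]
    by (subst distr_density_affine[OF M]) (simp_all add: norm mult.assoc)
qed

text \<open>Rotation invariance forces the covariance of a radial law to be a multiple of the identity:
  its second moments along any two unit vectors agree.\<close>

lemma radial_moments:
  fixes \<psi> :: "real \<Rightarrow> ennreal"
  assumes \<psi>[measurable]: "\<psi> \<in> borel_measurable borel"
    and mass: "(\<integral>\<^sup>+x. \<psi> ((norm (x :: real^'n))\<^sup>2) \<partial>lborel) = 1"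
    and second: "(\<integral>\<^sup>+x. ennreal ((norm (x :: real^'n))\<^sup>2) * \<psi> ((norm x)\<^sup>2) \<partial>lborel) = of_nat CARD('n)"
  shows "elliptic \<psi> 0 (mat 1 :: real^'n^'n) \<in> P2"
    "mean (elliptic \<psi> 0 (mat 1 :: real^'n^'n)) = 0"
    "covariance (elliptic \<psi> 0 (mat 1 :: real^'n^'n)) = mat 1"
proof -
  define \<mu> where "\<mu> = elliptic \<psi> 0 (mat 1 :: real^'n^'n)"
  have "matrix_inv (mat 1 :: real^'n^'n) = mat 1"
    using SPD_matrix_inv_mult(1)[OF SPD_mat_1] by simp
  then have \<mu>: "\<mu> = density lborel (\<lambda>x. \<psi> ((norm x)\<^sup>2))"
    by (simp add: \<mu>_def elliptic_def norm_V2_def power2_norm_eq_inner)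
  have nn: "(\<integral>\<^sup>+x. ennreal ((norm x)\<^sup>2) \<partial>\<mu>) = of_nat CARD('n)"
    unfolding \<mu> second[symmetric] by (subst nn_integral_density) (auto simp: mult.commute)
  have "prob_space \<mu>"
    by (rule prob_spaceI) (simp add: \<mu> emeasure_density mass)
  moreover have int: "integrable \<mu> (\<lambda>x. (norm x)\<^sup>2)"
    by (rule integrableI_nonneg) (auto simp: nn of_nat_less_top, simp add: \<mu>)
  ultimately show P2: "elliptic \<psi> 0 (mat 1 :: real^'n^'n) \<in> P2"
    unfolding \<mu>_def[symmetric] by (simp add: P2_def \<mu>)
  note P2 = P2[folded \<mu>_def]
  have total: "(\<integral>x. (norm x)\<^sup>2 \<partial>\<mu>) = real CARD('n)"
    by (subst integral_eq_nn_integral) (auto simp: nn, simp add: \<mu>)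
  have invariant: "distr \<mu> borel f = \<mu>" if "orthogonal_transformation f" for f
  proof -
    have Q: "orthogonal_matrix (matrix f)" and f: "(*v) (matrix f) = f"
      using that by (auto simp: orthogonal_transformation_matrix)
    then have "invertible (matrix f)" "matrix f ** transpose (matrix f) = mat 1"
      by (auto simp: orthogonal_matrix_def invertible_def)
    then show ?thesis
      using distr_elliptic[OF \<psi> SPD_mat_1, of "matrix f" 0 0] by (simp add: \<mu>_def f)
  qed
  have mean0: "mean \<mu> = 0"
  proof -
    have "orthogonal_transformation (uminus :: real^'n \<Rightarrow> _)"
      by (simp add: orthogonal_transformation_def linear_uminus)
    from invariant[OF this] have "mean \<mu> = mean (distr \<mu> borel uminus)"
      by simp
    also have "\<dots> = - mean \<mu>"
      unfolding mean_def by (subst integral_distr) (auto simp: P2_measurable[OF P2])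
    finally show ?thesis by (simp add: eq_neg_iff_add_eq_0 flip: scaleR_2)
  qed
  then show "mean (elliptic \<psi> 0 (mat 1 :: real^'n^'n)) = 0" by (simp add: \<mu>_def)
  have iso: "(\<integral>x. (x \<bullet> a)\<^sup>2 \<partial>\<mu>) = (\<integral>x. (x \<bullet> b)\<^sup>2 \<partial>\<mu>)" if ab: "norm a = norm b" for a b
  proof -
    obtain f :: "real^'n \<Rightarrow> real^'n" where f: "orthogonal_transformation f" "f b = a"
      using orthogonal_transformation_exists[OF ab[symmetric]] by blast
    have [measurable]: "f \<in> borel_measurable borel"
      using orthogonal_transformation_linear[OF f(1)]
      by (intro borel_measurable_continuous_onI linear_continuous_on) (simp add: linear_linear)
    have "(\<integral>x. (x \<bullet> a)\<^sup>2 \<partial>\<mu>) = (\<integral>x. (x \<bullet> a)\<^sup>2 \<partial>distr \<mu> borel f)"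
      by (simp add: invariant[OF f(1)])
    also have "\<dots> = (\<integral>x. (f x \<bullet> f b)\<^sup>2 \<partial>\<mu>)"
      using f(2) by (subst integral_distr) (auto simp: P2_measurable[OF P2])
    also have "\<dots> = (\<integral>x. (x \<bullet> b)\<^sup>2 \<partial>\<mu>)" using f(1) by (simp add: orthogonal_transformation_def)
    finally show ?thesis .
  qed
  have cov: "covariance \<mu> $ i $ j = (\<integral>x. (x \<bullet> axis i 1) * (x \<bullet> axis j 1) \<partial>\<mu>)" for i j
    by (simp add: covariance_def mean0 inner_axis)
  \<comment> \<open>The vectors \<open>axis i 1 + axis j 1\<close> and
    \<open>axis i 1 - axis j 1\<close> have equal norm, hence equal second moments; polarisation
    leaves four times the mixed moment.\<close>
  have "covariance \<mu> $ i $ j = 0" if "i \<noteq> j" for i j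
  proof -
    have "norm (axis i 1 + axis j 1 :: real^'n) = norm (axis i 1 - axis j 1 :: real^'n)"
      using that by (simp add: norm_eq inner_axis_axis inner_simps)
    note iso[OF this]
    moreover have "integrable \<mu> (\<lambda>x. (x \<bullet> a)\<^sup>2)" for a
      using P2_integrable_inner_mult[OF P2, of a a] by (simp add: power2_eq_square)
    ultimately have "(\<integral>x. (x \<bullet> (axis i 1 + axis j 1))\<^sup>2 - (x \<bullet> (axis i 1 - axis j 1))\<^sup>2 \<partial>\<mu>) = 0"
      by (subst Bochner_Integration.integral_diff) auto
    moreover have "(x \<bullet> (axis i 1 + axis j 1))\<^sup>2 - (x \<bullet> (axis i 1 - axis j 1))\<^sup>2 =
        4 * ((x \<bullet> axis i 1) * (x \<bullet> axis j 1))" for x :: "real^'n"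
      by (simp add: inner_add_right inner_diff_right power2_eq_square algebra_simps)
    ultimately show ?thesis by (simp add: cov)
  qed
  \<comment> \<open>The diagonal entries agree, and their sum is the prescribed second moment, the
    dimension.\<close>
  moreover have "covariance \<mu> $ i $ i = 1" for i
  proof -
    have "covariance \<mu> $ k $ k = covariance \<mu> $ i $ i" for k
      using iso[of "axis k 1" "axis i 1"] by (simp add: cov power2_eq_square norm_axis_1)
    then have "(\<Sum>k\<in>UNIV. covariance \<mu> $ k $ k) = (\<Sum>k\<in>(UNIV :: 'n set). covariance \<mu> $ i $ i)"
      by (rule sum.cong[OF refl])
    then have "trace (covariance \<mu>) = real CARD('n) * covariance \<mu> $ i $ i"
      by (simp add: trace_def)
    moreover have "trace (covariance \<mu>) = real CARD('n)"
      using integral_norm_square[OF P2] total mean0 by simp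
    ultimately show ?thesis by simp
  qed
  ultimately show "covariance (elliptic \<psi> 0 (mat 1 :: real^'n^'n)) = mat 1"
    unfolding \<mu>_def[symmetric] by (simp add: vec_eq_iff mat_def)
qed

text \<open>Every member is the image of the standard radial one under a translate of a square root
  of \<open>V\<close>.\<close>

lemma elliptic_moments:
  fixes \<psi> :: "real \<Rightarrow> ennreal" and V :: "real^'n^'n"
  assumes \<psi>: "\<psi> \<in> borel_measurable borel"
    and "(\<integral>\<^sup>+x. \<psi> ((norm (x :: real^'n))\<^sup>2) \<partial>lborel) = 1"
    and "(\<integral>\<^sup>+x. ennreal ((norm (x :: real^'n))\<^sup>2) * \<psi> ((norm x)\<^sup>2) \<partial>lborel) = of_nat CARD('n)"
    and V: "V \<in> SPD"
  shows "elliptic \<psi> v V \<in> P2" "mean (elliptic \<psi> v V) = v" "covariance (elliptic \<psi> v V) = V"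
proof -
  obtain S where S: "S \<in> SPD" "S ** S = V" by (rule SPD_sqrt[OF V])
  have "elliptic \<psi> v V = distr (elliptic \<psi> 0 (mat 1)) borel (\<lambda>x. v + S *v (x - 0))"
    using distr_elliptic[OF \<psi> SPD_mat_1 SPD_invertible[OF S(1)], of 0 v] S
    by (simp add: SPD_transpose)
  note eq = this and std = radial_moments[OF assms(1-3)]
  show "elliptic \<psi> v V \<in> P2" unfolding eq by (rule P2_distr_affine[OF std(1)])
  show "mean (elliptic \<psi> v V) = v" unfolding eq mean_distr_affine[OF std(1)] by (simp add: std)
  show "covariance (elliptic \<psi> v V) = V"
    unfolding eq covariance_distr_affine[OF std(1)] using S by (simp add: std SPD_transpose)
qed

section \<open>Wasserstein distance in location-scatter families\<close>

text \<open>Polarisation writes the inner product through squared norms of three affine images, each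
  integrable by closure of \<open>P2\<close> under affine maps.\<close>

lemma P2_integrable_inner_affine:
  fixes \<mu> :: "(real^'n) measure" and M N :: "real^'n^'n"
  assumes "\<mu> \<in> P2"
  shows "integrable \<mu> (\<lambda>x. (u + M *v (x - c)) \<bullet> (w + N *v (x - c)))"
proof -
  have sq: "integrable \<mu> (\<lambda>x. (norm (a + A *v (x - c)))\<^sup>2)" for a and A :: "real^'n^'n"
    using P2D(3)[OF P2_distr_affine[OF assms, of a A c]]
    by (subst (asm) integrable_distr_eq) (auto simp: P2_measurable[OF assms])
  have diff: "(u + M *v (x - c)) - (w + N *v (x - c)) = (u - w) + (M - N) *v (x - c)" for x
    by (simp add: matrix_vector_mult_diff_rdistrib)
  have eq: "(u + M *v (x - c)) \<bullet> (w + N *v (x - c)) =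
      ((norm (u + M *v (x - c)))\<^sup>2 + (norm (w + N *v (x - c)))\<^sup>2 - (norm ((u - w) + (M - N) *v (x - c)))\<^sup>2) / 2" for x
    unfolding diff[symmetric] power2_norm_eq_inner by (simp add: inner_diff_left inner_diff_right inner_commute)
  show ?thesis
    unfolding eq
    by (intro integrable_divide Bochner_Integration.integrable_add Bochner_Integration.integrable_diff sq)
qed

lemma coupling_integral:
  fixes f :: "'a::euclidean_space \<Rightarrow> real"
  assumes "\<pi> \<in> couplings \<mu> \<nu>" "f \<in> borel_measurable borel"
  shows "integrable \<mu> f \<longleftrightarrow> integrable \<pi> (\<lambda>p. f (fst p))" "(\<integral>x. f x \<partial>\<mu>) = (\<integral>p. f (fst p) \<partial>\<pi>)"
    "integrable \<nu> f \<longleftrightarrow> integrable \<pi> (\<lambda>p. f (snd p))" "(\<integral>x. f x \<partial>\<nu>) = (\<integral>p. f (snd p) \<partial>\<pi>)"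
proof -
  have \<pi>: "sets \<pi> = sets (borel \<Otimes>\<^sub>M borel)" "\<mu> = distr \<pi> borel fst" "\<nu> = distr \<pi> borel snd"
    using assms(1) by (auto simp: couplings_def)
  have m: "fst \<in> measurable \<pi> borel" "snd \<in> measurable \<pi> borel"
    by (simp_all cong: measurable_cong_sets[OF \<pi>(1) refl])
  show "integrable \<mu> f \<longleftrightarrow> integrable \<pi> (\<lambda>p. f (fst p))" "(\<integral>x. f x \<partial>\<mu>) = (\<integral>p. f (fst p) \<partial>\<pi>)"
    unfolding \<pi>(2) using m assms(2) by (simp_all add: integrable_distr_eq integral_distr)
  show "integrable \<nu> f \<longleftrightarrow> integrable \<pi> (\<lambda>p. f (snd p))" "(\<integral>x. f x \<partial>\<nu>) = (\<integral>p. f (snd p) \<partial>\<pi>)"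
    unfolding \<pi>(3) using m assms(2) by (simp_all add: integrable_distr_eq integral_distr)
qed

text \<open>Weak Kantorovich duality: a pair of potentials that is tight on the graph of \<open>\<tau>\<close>
  certifies that the deterministic coupling along \<open>\<tau>\<close> is optimal.\<close>

lemma W2_eq_of_potentials:
  fixes \<mu> :: "'a::euclidean_space measure" and f g :: "'a \<Rightarrow> real"
  assumes \<mu>: "\<mu> \<in> P2" and \<nu>: "distr \<mu> borel \<tau> \<in> P2"
    and [measurable]: "\<tau> \<in> borel_measurable borel" "f \<in> borel_measurable borel" "g \<in> borel_measurable borel"
    and f: "integrable \<mu> f" and g: "integrable (distr \<mu> borel \<tau>) g"
    and le: "\<And>x y. f x + g y \<le> (norm (x - y))\<^sup>2"
    and tight: "\<And>x. f x + g (\<tau> x) = (norm (x - \<tau> x))\<^sup>2"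
  shows "W2 \<mu> (distr \<mu> borel \<tau>) = sqrt (\<integral>x. (norm (x - \<tau> x))\<^sup>2 \<partial>\<mu>)"
proof -
  define \<nu> where "\<nu> = distr \<mu> borel \<tau>"
  note meas = P2_measurable[OF \<mu>]
  have m\<tau>: "\<tau> \<in> measurable \<mu> borel" by (simp add: meas)
  define \<pi>\<^sub>0 where "\<pi>\<^sub>0 = distr \<mu> (borel \<Otimes>\<^sub>M borel) (\<lambda>x. (x, \<tau> x))"
  have m0: "(\<lambda>x. (x, \<tau> x)) \<in> measurable \<mu> (borel \<Otimes>\<^sub>M borel)" unfolding meas by measurable
  have "\<pi>\<^sub>0 \<in> couplings \<mu> \<nu>"
    using m0 P2D(2)[OF \<mu>] by (auto simp: couplings_def \<pi>\<^sub>0_def \<nu>_def distr_distr o_def distr_id2)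
  moreover have cost0: "(\<integral>p. (norm (fst p - snd p))\<^sup>2 \<partial>\<pi>\<^sub>0) = (\<integral>x. (norm (x - \<tau> x))\<^sup>2 \<partial>\<mu>)"
    unfolding \<pi>\<^sub>0_def by (subst integral_distr[OF m0]) auto
  moreover have "(\<integral>x. (norm (x - \<tau> x))\<^sup>2 \<partial>\<mu>) \<le> (\<integral>p. (norm (fst p - snd p))\<^sup>2 \<partial>\<pi>)"
    if \<pi>: "\<pi> \<in> couplings \<mu> \<nu>" for \<pi>
  proof -
    have sets: "sets \<pi> = sets (borel \<Otimes>\<^sub>M borel)" using \<pi> by (simp add: couplings_def)
    have int: "integrable \<pi> (\<lambda>p. (norm (fst p))\<^sup>2)" "integrable \<pi> (\<lambda>p. (norm (snd p))\<^sup>2)"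
      "integrable \<pi> (\<lambda>p. f (fst p))" "integrable \<pi> (\<lambda>p. g (snd p))"
      using coupling_integral[OF \<pi>] P2D(3)[OF \<mu>] P2D(3)[OF \<nu>] f g by (simp_all add: \<nu>_def)
    \<comment> \<open>Integrability must precede the comparison: the Bochner integral of a
      non-integrable cost would default to 0 and void the lower bound.\<close>
    have "integrable \<pi> (\<lambda>p. (norm (fst p - snd p))\<^sup>2)"
    proof (rule Bochner_Integration.integrable_bound)
      show "integrable \<pi> (\<lambda>p. 2 * (norm (fst p))\<^sup>2 + 2 * (norm (snd p))\<^sup>2)" using int by simp
      show "(\<lambda>p. (norm (fst p - snd p))\<^sup>2) \<in> borel_measurable \<pi>"
        by (simp cong: measurable_cong_sets[OF sets refl])
      have "(norm (x - y))\<^sup>2 \<le> 2 * (norm x)\<^sup>2 + 2 * (norm y)\<^sup>2" for x y :: 'a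
      proof -
        have "(norm (x - y))\<^sup>2 \<le> (norm x + norm y)\<^sup>2" by (intro power_mono norm_triangle_ineq4) auto
        then show ?thesis using sum_squares_bound[of "norm x" "norm y"] by (simp add: power2_sum)
      qed
      then show "AE p in \<pi>. norm ((norm (fst p - snd p))\<^sup>2) \<le> norm (2 * (norm (fst p))\<^sup>2 + 2 * (norm (snd p))\<^sup>2)"
        by simp
    qed
    then have "(\<integral>p. f (fst p) + g (snd p) \<partial>\<pi>) \<le> (\<integral>p. (norm (fst p - snd p))\<^sup>2 \<partial>\<pi>)"
      using int le by (intro integral_mono) auto
    moreover have "(\<integral>p. f (fst p) + g (snd p) \<partial>\<pi>) = (\<integral>x. f x \<partial>\<mu>) + (\<integral>y. g y \<partial>\<nu>)"
      using int coupling_integral[OF \<pi>] by simp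
    moreover have "(\<integral>y. g y \<partial>\<nu>) = (\<integral>x. g (\<tau> x) \<partial>\<mu>)"
      unfolding \<nu>_def by (rule integral_distr[OF m\<tau>]) simp
    moreover have "(\<integral>x. f x \<partial>\<mu>) + (\<integral>x. g (\<tau> x) \<partial>\<mu>) = (\<integral>x. (norm (x - \<tau> x))\<^sup>2 \<partial>\<mu>)"
      unfolding tight[symmetric] using f g
      by (subst Bochner_Integration.integral_add) (auto simp: integrable_distr_eq m\<tau>)
    ultimately show ?thesis by simp
  qed
  ultimately show ?thesis
    unfolding W2_def \<nu>_def[symmetric]
    by (intro cInf_eq_minimum) (auto intro!: image_eqI[of _ _ \<pi>\<^sub>0])
qed

lemma W2_affine_map:
  fixes \<mu> :: "(real^'n) measure" and T :: "real^'n^'n"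
  assumes \<mu>: "\<mu> \<in> P2" and T: "T \<in> SPD"
  shows "W2 \<mu> (distr \<mu> borel (\<lambda>x. u + T *v (x - c))) = sqrt (\<integral>x. (norm (x - (u + T *v (x - c))))\<^sup>2 \<partial>\<mu>)"
proof -
  define S where "S = matrix_inv T"
  have S: "S *v (T *v x) = x" "T *v (S *v x) = x" for x
    using SPD_matrix_inv_mult_vec[OF T] by (simp_all add: S_def)
  \<comment> \<open>The potentials are \<open>norm\<close> squared minus twice a Legendre pair: the
    convex quadratic with gradient \<open>u + T *v (x - c)\<close>, and its conjugate, in which
    \<open>S\<close> replaces \<open>T\<close>.\<close>
  define f where "f = (\<lambda>x. (norm x)\<^sup>2 - (x - c) \<bullet> (T *v (x - c)) - 2 * ((x - c) \<bullet> u) - 2 * (c \<bullet> u))"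
  define g where "g = (\<lambda>y. (norm y)\<^sup>2 - (y - u) \<bullet> (S *v (y - u)) - 2 * ((y - u) \<bullet> c))"
  have expand: "(norm (x - y))\<^sup>2 - (f x + g y) =
      (x - c) \<bullet> (T *v (x - c)) + (y - u) \<bullet> (S *v (y - u)) - 2 * ((x - c) \<bullet> (y - u))" for x y
    by (simp add: f_def g_def power2_norm_eq_inner inner_diff_left inner_diff_right inner_commute
        matrix_vector_mult_diff_distrib)
  \<comment> \<open>Completing the square: the duality defect is a \<open>T\<close>-norm of
    \<open>a - S *v b\<close>, nonnegative and zero exactly on the graph of the map.\<close>
  have square: "a \<bullet> (T *v a) + b \<bullet> (S *v b) - 2 * (a \<bullet> b) = (a - S *v b) \<bullet> (T *v (a - S *v b))" for a b
  proof -
    have "(S *v b) \<bullet> (T *v a) = b \<bullet> a"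
      using SPD_inner[OF T, of "S *v b" a] by (simp add: S)
    then show ?thesis
      by (simp add: matrix_vector_mult_diff_distrib S inner_diff_left inner_diff_right inner_commute)
  qed
  have nonneg: "0 \<le> a \<bullet> (T *v a)" for a
    using SPD_pos[OF T, of a] by (cases "a = 0") auto
  note P2' = P2_distr_affine[OF \<mu>, of u T c]
  have int: "integrable \<nu> (\<lambda>x. (x - w) \<bullet> (A *v (x - w)))" "integrable \<nu> (\<lambda>x. (x - w) \<bullet> z)"
    if "\<nu> \<in> P2" for \<nu> :: "(real^'n) measure" and w z and A :: "real^'n^'n"
    using P2_integrable_inner_affine[OF that, of 0 "mat 1" w 0 A]
      P2_integrable_inner_affine[OF that, of 0 "mat 1" w z 0] by simp_all
  show ?thesis
  proof (rule W2_eq_of_potentials[where f = f and g = g])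
    show "integrable \<mu> f"
      unfolding f_def
      by (intro Bochner_Integration.integrable_diff integrable_mult_right int[OF \<mu>] P2D(3)[OF \<mu>]
          P2_integrable_const[OF \<mu>])
    show "integrable (distr \<mu> borel (\<lambda>x. u + T *v (x - c))) g"
      unfolding g_def
      by (intro Bochner_Integration.integrable_diff integrable_mult_right int[OF P2'] P2D(3)[OF P2'])
    show "f x + g y \<le> (norm (x - y))\<^sup>2" for x y
      using expand[of x y] square[of "x - c" "y - u"] nonneg[of "x - c - S *v (y - u)"] by simp
    show "f x + g (u + T *v (x - c)) = (norm (x - (u + T *v (x - c))))\<^sup>2" for x
      using expand[of x "u + T *v (x - c)"] square[of "x - c" "T *v (x - c)"] by (simp add: S)
  qed (use \<mu> P2' in \<open>simp_all add: f_def g_def\<close>)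
qed

lemma trace_scaleR: "trace (k *\<^sub>R (A :: real^'n^'n)) = k * trace A"
  by (simp add: trace_def sum_distrib_left)

text \<open>Everything the geometry uses about a family: second moments, parametrisation by mean and
  covariance, and affine equivariance. Densities do not enter from here on, so the
  \<phi>-exponential and Gaussian families are treated alike.\<close>

locale location_scatter_family =
  fixes F :: "real^'n \<Rightarrow> real^'n^'n \<Rightarrow> (real^'n) measure"
  assumes P2: "V \<in> SPD \<Longrightarrow> F v V \<in> P2"
    and mean: "V \<in> SPD \<Longrightarrow> mean (F v V) = v"
    and covariance: "V \<in> SPD \<Longrightarrow> covariance (F v V) = V"
    and affine: "V \<in> SPD \<Longrightarrow> invertible M \<Longrightarrow>
      distr (F v V) borel (\<lambda>x. u + M *v (x - v)) = F u (M ** V ** transpose M)"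
begin

text \<open>The optimal cost is the second moment of the displacement, whose law has mean
  \<open>u - v\<close> and covariance \<open>(T - mat 1) ** V ** transpose (T - mat 1)\<close>.
  \<open>F\<close> does not occur on the right-hand side, which is the source of the
  isometry.\<close>

lemma W2_family:
  assumes V: "V \<in> SPD" and T: "T \<in> SPD"
  shows "W2 (F v V) (F u (T ** V ** T)) =
    sqrt ((norm (u - v))\<^sup>2 + trace ((T - mat 1) ** V ** transpose (T - mat 1)))"
proof -
  have "W2 (F v V) (F u (T ** V ** T)) = sqrt (\<integral>x. (norm (x - (u + T *v (x - v))))\<^sup>2 \<partial>F v V)"
    using W2_affine_map[OF P2[OF V] T, of v u v] affine[OF V SPD_invertible[OF T], of v u]
    by (simp add: SPD_transpose[OF T])
  also have "(\<integral>x. (norm (x - (u + T *v (x - v))))\<^sup>2 \<partial>F v V) =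
      (\<integral>x. (norm ((u - v) + (T - mat 1) *v (x - v)))\<^sup>2 \<partial>F v V)"
    by (intro Bochner_Integration.integral_cong refl arg_cong[where f = "\<lambda>t. t\<^sup>2"])
       (simp add: matrix_vector_mult_diff_rdistrib norm_minus_commute algebra_simps)
  also have "\<dots> = (\<integral>y. (norm y)\<^sup>2 \<partial>distr (F v V) borel (\<lambda>x. (u - v) + (T - mat 1) *v (x - v)))"
    by (subst integral_distr) (auto simp: P2_measurable[OF P2[OF V]])
  also have "\<dots> = (norm (u - v))\<^sup>2 + trace ((T - mat 1) ** V ** transpose (T - mat 1))"
    unfolding integral_norm_square[OF P2_distr_affine[OF P2[OF V]]] mean_distr_affine[OF P2[OF V]]
      covariance_distr_affine[OF P2[OF V]] by (simp add: mean[OF V] covariance[OF V])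
  finally show ?thesis .
qed

text \<open>For constant speed the distance formula is needed between any two times. The map
  \<open>R\<close> from time s to time t is again symmetric positive definite, so
  \<open>W2_family\<close> applies to it, and its displacement is proportional to
  \<open>t - s\<close>.\<close>

lemma geodesic:
  assumes V: "V \<in> SPD" and U: "U \<in> SPD"
  obtains \<gamma> where "W2_geodesic \<gamma>" "\<gamma> 0 = F v V" "\<gamma> 1 = F u U"
    "\<forall>t\<in>{0..1}. \<exists>w W. \<gamma> t = F w W \<and> W \<in> SPD"
proof -
  obtain T where T: "T \<in> SPD" "T ** V ** T = U" by (rule SPD_transport[OF V U])
  define A where "A = (\<lambda>t. (1 - t) *\<^sub>R mat 1 + t *\<^sub>R T)"
  have Av: "A t *v x = (1 - t) *\<^sub>R x + t *\<^sub>R (T *v x)" for t x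
    by (simp add: A_def matrix_vector_mult_add_rdistrib scaleR_matrix_vector_assoc[symmetric])
  \<comment> \<open>The coefficients are symmetric in s and t, which later gives the symmetry of
    \<open>R\<close>; setting p = q gives its positivity.\<close>
  have bilin: "(A s *v p) \<bullet> (A t *v q) = (1 - s) * (1 - t) * (p \<bullet> q) +
      ((1 - s) * t + s * (1 - t)) * (p \<bullet> (T *v q)) + s * t * ((T *v p) \<bullet> (T *v q))" for s t p q
    using SPD_inner[OF T(1), of p q]
    by (simp add: Av inner_add_left inner_add_right algebra_simps)
  have bilin_pos: "0 < (A s *v p) \<bullet> (A t *v p)" if st: "s \<in> {0..1}" "t \<in> {0..1}" and "p \<noteq> 0" for s t p
  proof -
    \<comment> \<open>The three weights in \<open>bilin\<close> are nonnegative and sum to 1, so the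
      form dominates the least of its three terms.\<close>
    define m where "m = min (p \<bullet> p) (min (p \<bullet> (T *v p)) ((T *v p) \<bullet> (T *v p)))"
    have "T *v p \<noteq> 0" using SPD_pos[OF T(1) \<open>p \<noteq> 0\<close>] by auto
    then have "0 < m" using \<open>p \<noteq> 0\<close> SPD_pos[OF T(1) \<open>p \<noteq> 0\<close>] by (simp add: m_def)
    also have "m = (1 - s) * (1 - t) * m + ((1 - s) * t + s * (1 - t)) * m + s * t * m"
      by (simp add: algebra_simps)
    also have "\<dots> \<le> (A s *v p) \<bullet> (A t *v p)"
      unfolding bilin using st by (intro add_mono mult_left_mono) (auto simp: m_def)
    finally show ?thesis .
  qed
  have A1: "A 0 = mat 1" "A 1 = T" by (simp_all add: A_def)
  have A: "A t \<in> SPD" if "t \<in> {0..1}" for t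
  proof (rule SPD_I)
    show "(A t *v x) \<bullet> y = x \<bullet> (A t *v y)" for x y
      using SPD_inner[OF T(1)] by (simp add: Av inner_simps)
    show "0 < x \<bullet> (A t *v x)" if "x \<noteq> 0" for x
      using bilin_pos[of 0 t x] \<open>t \<in> {0..1}\<close> that by (simp add: A1)
  qed
  define W where "W = (\<lambda>t. A t ** V ** A t)"
  have W: "W t \<in> SPD" if "t \<in> {0..1}" for t
    using SPD_congruence[OF V SPD_invertible[OF A[OF that]]] SPD_transpose[OF A[OF that]]
    by (simp add: W_def)
  define \<gamma> where "\<gamma> = (\<lambda>t. F ((1 - t) *\<^sub>R v + t *\<^sub>R u) (W t))"
  define E where "E = (norm (u - v))\<^sup>2 + trace ((T - mat 1) ** V ** transpose (T - mat 1))"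
  have dist: "W2 (\<gamma> s) (\<gamma> t) = \<bar>s - t\<bar> * sqrt E" if s: "s \<in> {0..1}" and t: "t \<in> {0..1}" for s t
  proof -
    define R where "R = A t ** matrix_inv (A s)"
    note inv = SPD_matrix_inv_mult_vec[OF A[OF s]]
    have Rv: "R *v x = A t *v (matrix_inv (A s) *v x)" for x by (simp add: R_def matrix_vector_mul_assoc)
    have R: "R \<in> SPD"
    proof (rule SPD_I)
      fix x y
      define p q where "p = matrix_inv (A s) *v x" and "q = matrix_inv (A s) *v y"
      have xy: "x = A s *v p" "y = A s *v q" by (simp_all add: p_def q_def inv)
      have "R *v x = A t *v p" "R *v y = A t *v q" by (simp_all add: Rv p_def q_def)
      note Rxy = this
      show "(R *v x) \<bullet> y = x \<bullet> (R *v y)"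
        unfolding Rxy unfolding xy bilin by (simp add: algebra_simps)
      assume "x \<noteq> 0"
      then have "p \<noteq> 0" using xy by auto
      from bilin_pos[OF s t this] show "0 < x \<bullet> (R *v x)"
        unfolding Rxy unfolding xy .
    qed
    have RA: "R ** A s = A t"
      using SPD_matrix_inv_mult(2)[OF A[OF s]] by (simp add: R_def matrix_mul_assoc[symmetric])
    have "transpose (R ** A s) = A s ** R"
      by (simp add: matrix_transpose_mul SPD_transpose[OF A[OF s]] SPD_transpose[OF R])
    then have AR: "A s ** R = A t" by (simp add: RA SPD_transpose[OF A[OF t]])
    have "R ** W s ** R = (R ** A s) ** V ** (A s ** R)"
      by (simp add: W_def matrix_mul_assoc)
    then have "R ** W s ** R = W t" by (simp add: RA AR W_def)
    then have "W2 (\<gamma> s) (\<gamma> t) = sqrt ((norm ((1 - t) *\<^sub>R v + t *\<^sub>R u - ((1 - s) *\<^sub>R v + s *\<^sub>R u)))\<^sup>2 +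
        trace ((R - mat 1) ** W s ** transpose (R - mat 1)))"
      using W2_family[OF W[OF s] R] by (simp add: \<gamma>_def)
    moreover have "(norm ((1 - t) *\<^sub>R v + t *\<^sub>R u - ((1 - s) *\<^sub>R v + s *\<^sub>R u)))\<^sup>2 = (t - s)\<^sup>2 * (norm (u - v))\<^sup>2"
    proof -
      have "(1 - t) *\<^sub>R v + t *\<^sub>R u - ((1 - s) *\<^sub>R v + s *\<^sub>R u) = (t - s) *\<^sub>R (u - v)"
        by (simp add: algebra_simps)
      then show ?thesis by (simp add: power_mult_distrib)
    qed
    moreover have "(R - mat 1) ** W s ** transpose (R - mat 1) =
        (t - s)\<^sup>2 *\<^sub>R ((T - mat 1) ** V ** transpose (T - mat 1))"
    proof -
      \<comment> \<open>Since R maps the time-s matrix to the time-t one, this is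
        \<open>A t - A s\<close>, and \<open>A\<close> is affine in time.\<close>
      have D: "(R - mat 1) ** A s = (t - s) *\<^sub>R (T - mat 1)"
      proof -
        have "R *v (A s *v x) = A t *v x" for x by (simp add: matrix_vector_mul_assoc RA)
        then have "((R - mat 1) ** A s) *v x = A t *v x - A s *v x" for x
          by (simp add: matrix_vector_mul_assoc[symmetric] matrix_vector_mult_diff_rdistrib)
        then show ?thesis
          by (simp add: matrix_eq matrix_vector_mult_diff_rdistrib scaleR_matrix_vector_assoc[symmetric]
              Av algebra_simps)
      qed
      have "(R - mat 1) ** W s ** transpose (R - mat 1) =
          ((R - mat 1) ** A s) ** V ** transpose ((R - mat 1) ** A s)"
        using SPD_transpose[OF A[OF s]] by (simp add: W_def matrix_mul_assoc matrix_transpose_mul)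
      also have "\<dots> = (t - s)\<^sup>2 *\<^sub>R ((T - mat 1) ** V ** transpose (T - mat 1))"
        unfolding D by (simp add: transpose_scalar matrix_scalar_ac scalar_matrix_assoc[symmetric] power2_eq_square)
      finally show ?thesis .
    qed
    ultimately have "W2 (\<gamma> s) (\<gamma> t) = sqrt ((t - s)\<^sup>2 * E)"
      by (simp only: E_def trace_scaleR distrib_left)
    then show ?thesis by (simp add: real_sqrt_mult abs_minus_commute)
  qed
  show thesis
  proof (rule that)
    have "W2 (\<gamma> 0) (\<gamma> 1) = sqrt E" using dist[of 0 1] by simp
    then have "W2 (\<gamma> s) (\<gamma> t) = \<bar>s - t\<bar> * W2 (\<gamma> 0) (\<gamma> 1)"
      if "s \<in> {0..1}" "t \<in> {0..1}" for s t
      using dist[OF that] by simp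
    moreover have "\<gamma> t \<in> P2" if "t \<in> {0..1}" for t using P2[OF W[OF that]] by (simp add: \<gamma>_def)
    ultimately show "W2_geodesic \<gamma>" unfolding W2_geodesic_def by blast
    show "\<gamma> 0 = F v V" "\<gamma> 1 = F u U" by (simp_all add: \<gamma>_def W_def A1 T(2))
    show "\<forall>t\<in>{0..1}. \<exists>w W. \<gamma> t = F w W \<and> W \<in> SPD" unfolding \<gamma>_def using W by blast
  qed
qed

lemma W2_convex_family: "W2_convex {F v V | v V. V \<in> SPD}"
  unfolding W2_convex_def
proof (intro conjI ballI)
  fix \<mu> \<nu> assume "\<mu> \<in> {F v V | v V. V \<in> SPD}" "\<nu> \<in> {F v V | v V. V \<in> SPD}"
  then obtain v V u U where *: "\<mu> = F v V" "V \<in> SPD" "\<nu> = F u U" "U \<in> SPD" by blast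
  obtain \<gamma> where "W2_geodesic \<gamma>" "\<gamma> 0 = F v V" "\<gamma> 1 = F u U"
    "\<forall>t\<in>{0..1}. \<exists>w W. \<gamma> t = F w W \<and> W \<in> SPD"
    by (rule geodesic[OF *(2,4)])
  with * show "\<exists>\<gamma>. W2_geodesic \<gamma> \<and> \<gamma> 0 = \<mu> \<and> \<gamma> 1 = \<nu> \<and> (\<forall>t\<in>{0..1}. \<gamma> t \<in> {F v V | v V. V \<in> SPD})"
    by (intro exI[of _ \<gamma>]) blast
qed (use P2 in auto)

end

text \<open>The bijection matches mean and covariance, which recover the parameters of a member. One
  and the same \<open>T\<close> computes the distance in both families.\<close>

lemma W2_isometric_families:
  fixes F G :: "real^'n \<Rightarrow> real^'n^'n \<Rightarrow> (real^'n) measure"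
  assumes "location_scatter_family F" "location_scatter_family G"
  shows "W2_isometric {F v V | v V. V \<in> SPD} {G v V | v V. V \<in> SPD}"
proof -
  interpret F: location_scatter_family F by fact
  interpret G: location_scatter_family G by fact
  define f where "f = (\<lambda>\<mu>. G (mean \<mu>) (covariance \<mu>))"
  have f: "f (F v V) = G v V" if "V \<in> SPD" for v V
    using that by (simp add: f_def F.mean F.covariance)
  have "bij_betw f {F v V | v V. V \<in> SPD} {G v V | v V. V \<in> SPD}"
  proof (rule bij_betwI')
    fix \<mu> \<nu> assume "\<mu> \<in> {F v V | v V. V \<in> SPD}" "\<nu> \<in> {F v V | v V. V \<in> SPD}"
    then obtain v V u U where *: "\<mu> = F v V" "V \<in> SPD" "\<nu> = F u U" "U \<in> SPD" by blast
    have "v = u" "V = U" if "G v V = G u U"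
      using * that G.mean[of V v] G.mean[of U u] G.covariance[of V v] G.covariance[of U u] by auto
    moreover have "G v V = G u U" if "f \<mu> = f \<nu>" using that * f by simp
    ultimately show "(f \<mu> = f \<nu>) = (\<mu> = \<nu>)" using * by blast
  next
    fix \<mu> assume "\<mu> \<in> {F v V | v V. V \<in> SPD}"
    then show "f \<mu> \<in> {G v V | v V. V \<in> SPD}" using f by blast
  next
    fix \<nu> assume "\<nu> \<in> {G v V | v V. V \<in> SPD}"
    then show "\<exists>\<mu>\<in>{F v V | v V. V \<in> SPD}. \<nu> = f \<mu>" using f by fastforce
  qed
  moreover have "W2 (f \<mu>) (f \<nu>) = W2 \<mu> \<nu>"
    if \<mu>\<nu>: "\<mu> \<in> {F v V | v V. V \<in> SPD}" "\<nu> \<in> {F v V | v V. V \<in> SPD}" for \<mu> \<nu>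
  proof -
    obtain v V u U where *: "\<mu> = F v V" "V \<in> SPD" "\<nu> = F u U" "U \<in> SPD" using \<mu>\<nu> by blast
    obtain T where T: "T \<in> SPD" "T ** V ** T = U" by (rule SPD_transport[OF *(2,4)])
    show ?thesis
      using F.W2_family[OF *(2) T(1), of v u] G.W2_family[OF *(2) T(1), of v u] * f T(2) by simp
  qed
  ultimately show ?thesis
    unfolding W2_isometric_def using F.P2 G.P2 by (intro conjI exI[of _ f]) auto
qed

lemma location_scatter_elliptic:
  fixes \<psi> :: "real \<Rightarrow> ennreal"
  assumes "\<psi> \<in> borel_measurable borel"
    and "\<And>(v :: real^'n) V. V \<in> SPD \<Longrightarrow> elliptic \<psi> v V \<in> P2 \<and> mean (elliptic \<psi> v V) = v \<and> covariance (elliptic \<psi> v V) = V"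
  shows "location_scatter_family (elliptic \<psi> :: real^'n \<Rightarrow> real^'n^'n \<Rightarrow> (real^'n) measure)"
  using assms by unfold_locales (auto simp: distr_elliptic)

section \<open>Gaussian measures\<close>

lemma nn_integral_std_normal_moments:
  "(\<integral>\<^sup>+x. ennreal (std_normal_density x) \<partial>lborel) = 1"
  "(\<integral>\<^sup>+x. ennreal (std_normal_density x * x\<^sup>2) \<partial>lborel) = 1"
proof -
  have "(\<integral>\<^sup>+x. ennreal (std_normal_density x * x ^ (2 * k)) \<partial>lborel) = ennreal (fact (2 * k) / (2 ^ k * fact k))" for k :: nat
    using std_normal_moment_even[of k]
    by (subst nn_integral_eq_integral) (auto simp: has_bochner_integral_iff)
  from this[of 0] this[of 1]
  show "(\<integral>\<^sup>+x. ennreal (std_normal_density x) \<partial>lborel) = 1"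
    "(\<integral>\<^sup>+x. ennreal (std_normal_density x * x\<^sup>2) \<partial>lborel) = 1" by simp_all
qed

lemma norm_square_Basis: "(norm x)\<^sup>2 = (\<Sum>b\<in>Basis. (x \<bullet> b)\<^sup>2)"
  unfolding power2_norm_eq_inner by (subst euclidean_inner) (simp add: power2_eq_square)

definition gaussian_profile :: "'n::finite itself \<Rightarrow> real \<Rightarrow> ennreal" where
  "gaussian_profile _ r = ennreal ((2 * pi) powr (- real CARD('n) / 2) * exp (- r / 2))"

lemma gaussian_profile_prod:
  fixes x :: "real^'n"
  shows "gaussian_profile TYPE('n) ((norm x)\<^sup>2) = (\<Prod>b\<in>Basis. ennreal (std_normal_density (x \<bullet> b)))"
proof -
  have "(\<Prod>b\<in>Basis. std_normal_density (x \<bullet> b)) =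
      (\<Prod>b\<in>(Basis :: (real^'n) set). 1 / sqrt (2 * pi)) * (\<Prod>b\<in>Basis. exp (- (x \<bullet> b)\<^sup>2 / 2))"
    by (simp only: std_normal_density_def prod.distrib)
  also have "(\<Prod>b\<in>Basis. exp (- (x \<bullet> b)\<^sup>2 / 2)) = exp (- (norm x)\<^sup>2 / 2)"
    by (simp add: exp_sum[symmetric] norm_square_Basis sum_divide_distrib sum_negf)
  also have "(\<Prod>b\<in>(Basis :: (real^'n) set). 1 / sqrt (2 * pi)) = (2 * pi) powr (- real CARD('n) / 2)"
  proof -
    have "1 / sqrt (2 * pi) = (2 * pi) powr (- (1 / 2))"
      unfolding powr_minus by (subst powr_half_sqrt) (simp_all add: divide_inverse)
    then have "(\<Prod>b\<in>(Basis :: (real^'n) set). 1 / sqrt (2 * pi)) = ((2 * pi) powr (- (1 / 2))) ^ CARD('n)"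
      by simp
    also have "\<dots> = (2 * pi) powr (- (1 / 2) * real CARD('n))" by (subst powr_power) (auto simp: mult.commute)
    finally show ?thesis by simp
  qed
  finally show ?thesis
    by (simp add: gaussian_profile_def prod_ennreal)
qed

lemma gaussian_profile_mass: "(\<integral>\<^sup>+x. gaussian_profile TYPE('n) ((norm (x :: real^'n))\<^sup>2) \<partial>lborel) = 1"
  unfolding gaussian_profile_prod
  by (subst nn_integral_lborel_prod) (auto simp: nn_integral_std_normal_moments)

lemma gaussian_profile_second_moment:
  "(\<integral>\<^sup>+x. ennreal ((norm (x :: real^'n))\<^sup>2) * gaussian_profile TYPE('n) ((norm x)\<^sup>2) \<partial>lborel) = of_nat CARD('n)"
proof -
  \<comment> \<open>For fixed b, a product over the coordinates c in which only the factor c = b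
    carries the extra square, so each summand factorises by Tonelli.\<close>
  define f where "f = (\<lambda>(b :: real^'n) c t. ennreal (std_normal_density t) * (if c = b then ennreal (t\<^sup>2) else 1))"
  have "ennreal ((norm x)\<^sup>2) * gaussian_profile TYPE('n) ((norm x)\<^sup>2) =
      (\<Sum>b\<in>Basis. \<Prod>c\<in>Basis. f b c (x \<bullet> c))" for x :: "real^'n"
  proof -
    have "(\<Prod>c\<in>Basis. f b c (x \<bullet> c)) = ennreal ((x \<bullet> b)\<^sup>2) * gaussian_profile TYPE('n) ((norm x)\<^sup>2)"
      if "b \<in> Basis" for b
      using that by (simp add: f_def gaussian_profile_prod prod.distrib mult.commute)
    then have "(\<Sum>b\<in>Basis. \<Prod>c\<in>Basis. f b c (x \<bullet> c)) =
        (\<Sum>b\<in>Basis. ennreal ((x \<bullet> b)\<^sup>2)) * gaussian_profile TYPE('n) ((norm x)\<^sup>2)"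
      unfolding sum_distrib_right by (rule sum.cong[OF refl])
    also have "(\<Sum>b\<in>Basis. ennreal ((x \<bullet> b)\<^sup>2)) = ennreal ((norm x)\<^sup>2)"
      by (simp add: sum_ennreal norm_square_Basis)
    finally show ?thesis ..
  qed
  then have "(\<integral>\<^sup>+x. ennreal ((norm (x :: real^'n))\<^sup>2) * gaussian_profile TYPE('n) ((norm x)\<^sup>2) \<partial>lborel) =
      (\<integral>\<^sup>+x. (\<Sum>b\<in>Basis. \<Prod>c\<in>Basis. f b c (x \<bullet> c)) \<partial>(lborel :: (real^'n) measure))"
    by simp
  also have "\<dots> = (\<Sum>b\<in>(Basis :: (real^'n) set). \<integral>\<^sup>+x. (\<Prod>c\<in>Basis. f b c (x \<bullet> c)) \<partial>lborel)"
    by (rule nn_integral_sum) (simp add: f_def)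
  also have "\<dots> = (\<Sum>b\<in>(Basis :: (real^'n) set). \<Prod>c\<in>(Basis :: (real^'n) set). \<integral>\<^sup>+t. f b c t \<partial>lborel)"
    by (intro sum.cong refl nn_integral_lborel_prod) (auto simp: f_def)
  also have "\<dots> = (\<Sum>b\<in>(Basis :: (real^'n) set). \<Prod>c\<in>(Basis :: (real^'n) set). 1)"
  proof (intro sum.cong prod.cong refl)
    show "(\<integral>\<^sup>+t. f b c t \<partial>lborel) = 1" for b c
      by (cases "c = b") (simp_all add: f_def nn_integral_std_normal_moments ennreal_mult[symmetric])
  qed
  finally show ?thesis by simp
qed

lemma gaussians_eq: "gaussians = {elliptic (gaussian_profile TYPE('n)) v V | (v :: real^'n) V. V \<in> SPD}"
proof -
  have "ennreal (gaussian_density v V x) =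
      gaussian_profile TYPE('n) (norm_V2 V (x - v)) * ennreal (det V powr (- 1 / 2))"
    for v x :: "real^'n" and V
    by (simp add: gaussian_density_def gaussian_profile_def ennreal_mult[symmetric] mult_ac)
  then show ?thesis by (simp add: gaussians_def elliptic_def)
qed

lemma location_scatter_gaussian:
  "location_scatter_family (elliptic (gaussian_profile TYPE('n)) :: real^'n \<Rightarrow> real^'n^'n \<Rightarrow> (real^'n) measure)"
proof (rule location_scatter_elliptic)
  show m: "gaussian_profile TYPE('n) \<in> borel_measurable borel"
    unfolding gaussian_profile_def[abs_def] by measurable
  show "elliptic (gaussian_profile TYPE('n)) v V \<in> P2 \<and> mean (elliptic (gaussian_profile TYPE('n)) v V) = v \<and>
      covariance (elliptic (gaussian_profile TYPE('n)) v V) = V" if "V \<in> SPD" for v :: "real^'n" and V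
    using elliptic_moments[OF m gaussian_profile_mass gaussian_profile_second_moment that] by blast
qed

section \<open>Moment ratios of layer-cake profiles\<close>

lemma powr_add_le:
  fixes a b q :: real
  assumes "0 \<le> a" "0 \<le> b" "0 \<le> q"
  shows "(a + b) powr q \<le> 2 powr q * (a powr q + b powr q)"
proof -
  have "(a + b) powr q \<le> (2 * max a b) powr q" using assms by (intro powr_mono2) auto
  also have "\<dots> = 2 powr q * max a b powr q" using assms by (simp add: powr_mult)
  also have "max a b powr q \<le> a powr q + b powr q" by (simp add: max_def)
  finally show ?thesis by simp
qed

lemma integrable_indicator_powr:
  fixes \<beta> m :: real
  assumes "\<beta> < 1" "0 < m"
  shows "integrable lborel (\<lambda>s. indicator {0<..m} s * s powr (- \<beta>))"
proof -
  have "(\<lambda>s. s powr (- \<beta>)) absolutely_integrable_on {0..m}"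
    using assms by (intro nonnegative_absolutely_integrable_1 integrable_on_powr_from_0) auto
  then have "set_integrable lebesgue {0<..m} (\<lambda>s. s powr (- \<beta>))"
    by (rule set_integrable_subset) auto
  then show ?thesis
    unfolding set_integrable_def by (subst (asm) integrable_completion) auto
qed

lemma integrable_indicator_Ioc: "integrable lborel (indicator {a<..b} :: real \<Rightarrow> real)"
  by (cases "a \<le> b") (auto intro!: integrable_real_indicator)

text \<open>\<open>g\<close> stands for \<open>ln_phi \<phi>\<close>. The bound at 0 makes gap
  powers up to \<open>p + 1\<close> integrable; the bound at infinity is the length
  \<open>m / 2\<close> of an interval times a lower bound \<open>m powr (- \<delta> - 1)\<close> for
  the slope.\<close>

locale profile_gap =
  fixes g :: "real \<Rightarrow> real" and p \<delta> :: real
  assumes g_less: "0 < s \<Longrightarrow> s < t \<Longrightarrow> g s < g t"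
    and g_continuous: "continuous_on {0<..} g"
    and p: "0 < p" and \<delta>: "0 < \<delta>" "\<delta> * (p + 1) < 1"
    and growth_at_0: "0 < m \<Longrightarrow> \<exists>K\<ge>0. \<forall>s\<in>{0<..m}. g m - g s \<le> K * s powr (- \<delta>)"
    and growth_at_top: "\<exists>m\<^sub>0>0. \<forall>m\<ge>m\<^sub>0. m powr (- \<delta>) / 2 \<le> g m - g (m / 2)"
begin

text \<open>The gap truncated to zero outside (0, m), so that \<open>I p\<close> and
  \<open>I (p + 1)\<close>, the A and B of the overview, are integrals over the whole line.\<close>

definition h :: "real \<Rightarrow> real \<Rightarrow> real" where
  "h m s = (if 0 < s then max 0 (g m - g s) else 0)"

definition I :: "real \<Rightarrow> real \<Rightarrow> real" where
  "I q m = (\<integral>s. h m s powr q \<partial>lborel)"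

lemma g_le: "0 < s \<Longrightarrow> s \<le> t \<Longrightarrow> g s \<le> g t"
  using g_less[of s t] by (cases "s = t") auto

lemma h_nonneg: "0 \<le> h m s" by (simp add: h_def)

lemma h_eq_0: "0 < m \<Longrightarrow> m \<le> s \<Longrightarrow> h m s = 0"
  using g_le[of m s] by (simp add: h_def)

lemma h_nonpos: "s \<le> 0 \<Longrightarrow> h m s = 0"
  by (simp add: h_def)

lemma h_pos: "0 < s \<Longrightarrow> s < m \<Longrightarrow> 0 < h m s"
  using g_less[of s m] by (simp add: h_def)

lemma h_antimono: "0 < s \<Longrightarrow> s \<le> t \<Longrightarrow> h m t \<le> h m s"
  using g_le[of s t] by (simp add: h_def)

lemma h_mono: "0 < m \<Longrightarrow> m \<le> m' \<Longrightarrow> h m s \<le> h m' s"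
  using g_le[of m m'] by (auto simp: h_def le_max_iff_disj)

lemma h_measurable [measurable]: "h m \<in> borel_measurable borel"
proof -
  have "(\<lambda>s. if s \<in> {0<..} then max 0 (g m - g s) else 0) \<in> borel_measurable borel"
    by (intro borel_measurable_continuous_on_if continuous_intros g_continuous) auto
  then show ?thesis by (simp add: h_def[abs_def])
qed

lemma integrable_h:
  assumes "0 < m" "0 < q" "q \<le> p + 1"
  shows "integrable lborel (\<lambda>s. h m s powr q)"
proof -
  obtain K where K: "0 \<le> K" "\<And>s. s \<in> {0<..m} \<Longrightarrow> g m - g s \<le> K * s powr (- \<delta>)"
    using growth_at_0[OF assms(1)] by blast
  have "\<delta> * q \<le> \<delta> * (p + 1)" using assms \<delta>(1) by (intro mult_left_mono) auto
  then have "\<delta> * q < 1" using \<delta>(2) by simp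
  from integrable_indicator_powr[OF this assms(1)]
  have "integrable lborel (\<lambda>s. K powr q * (indicator {0<..m} s * s powr (- (\<delta> * q))))" by simp
  then show ?thesis
  proof (rule Bochner_Integration.integrable_bound)
    have "h m s powr q \<le> K powr q * (indicator {0<..m} s * s powr (- (\<delta> * q)))" for s
    proof (cases "s \<in> {0<..m}")
      case True
      then have "h m s \<le> K * s powr (- \<delta>)" using K g_le[of s m] by (simp add: h_def)
      then have "h m s powr q \<le> (K * s powr (- \<delta>)) powr q"
        using assms by (intro powr_mono2 h_nonneg) auto
      also have "\<dots> = K powr q * s powr (- (\<delta> * q))"
        using K True by (simp add: powr_mult powr_powr)
      finally show ?thesis using True by simp
    qed (use assms h_eq_0[of m s] h_nonpos[of s m] in force)
    then show "AE s in lborel. norm (h m s powr q) \<le> norm (K powr q * (indicator {0<..m} s * s powr (- (\<delta> * q))))"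
      by (simp add: abs_mult)
  qed simp
qed

lemma nn_integral_h:
  assumes "0 < m" "0 < q" "q \<le> p + 1"
  shows "(\<integral>\<^sup>+s. ennreal (h m s powr q) \<partial>lborel) = ennreal (I q m)"
  unfolding I_def using integrable_h[OF assms] by (rule nn_integral_eq_integral) simp

text \<open>A Markov-type bound: the gap decreases in its second argument, so on (0, s] it is at
  least its value at s.\<close>

lemma I_lower:
  assumes "0 < s" "s \<le> m" "0 < q" "q \<le> p + 1"
  shows "s * h m s powr q \<le> I q m"
proof -
  have "s * h m s powr q = (\<integral>r. h m s powr q * indicator {0<..s} r \<partial>lborel)"
    using assms by simp
  also have "\<dots> \<le> I q m"
    unfolding I_def
  proof (rule integral_mono)
    show "integrable lborel (\<lambda>r. h m s powr q * indicator {0<..s} r)"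
      by (simp add: integrable_indicator_Ioc)
    show "integrable lborel (\<lambda>r. h m r powr q)" using assms by (intro integrable_h) auto
    show "h m s powr q * indicator {0<..s} r \<le> h m r powr q" for r
      using assms by (auto simp: indicator_def intro!: powr_mono2 h_nonneg h_antimono)
  qed
  finally show ?thesis .
qed

lemma I_pos:
  assumes "0 < m" "0 < q" "q \<le> p + 1"
  shows "0 < I q m"
proof -
  have "0 < m / 2 * h m (m / 2) powr q" using h_pos[of "m/2" m] assms by simp
  also have "\<dots> \<le> I q m" using assms by (intro I_lower) auto
  finally show ?thesis .
qed

lemma continuous_I:
  assumes "0 < a" "0 < q" "q \<le> p + 1"
  shows "continuous_on {a..b} (I q)"
proof (rule continuous_on_sequentiallyI)
  fix u x assume u: "\<forall>n. u n \<in> {a..b}" and x: "x \<in> {a..b}" and lim: "u \<longlonglongrightarrow> x"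
  have b: "0 < b" using x assms by auto
  show "(\<lambda>n. I q (u n)) \<longlonglongrightarrow> I q x"
    unfolding I_def
  proof (rule integral_dominated_convergence[where w = "\<lambda>s. h b s powr q"])
    show "integrable lborel (\<lambda>s. h b s powr q)" using b assms by (intro integrable_h)
    have "isCont g x" using g_continuous x assms by (simp add: continuous_on_eq_continuous_at)
    then have "(\<lambda>n. g (u n)) \<longlonglongrightarrow> g x" using lim by (rule isCont_tendsto_compose)
    then have "(\<lambda>n. h (u n) s) \<longlonglongrightarrow> h x s" for s
      by (auto simp: h_def intro!: tendsto_intros)
    then show "AE s in lborel. (\<lambda>n. h (u n) s powr q) \<longlonglongrightarrow> h x s powr q"
      using assms by (intro AE_I2 tendsto_powr') (auto simp: h_nonneg)
    show "AE s in lborel. norm (h (u n) s powr q) \<le> h b s powr q" for n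
      using u[rule_format, of n] assms by (auto intro!: powr_mono2 h_nonneg h_mono)
  qed auto
qed

text \<open>The optimal \<open>t\<close> in \<open>h powr p \<le> t powr p + h powr (p + 1) / t\<close> (on the support of \<open>h\<close>) gives a
  reverse bound between the two moments that degenerates as \<open>m\<close> tends to \<open>0\<close>.\<close>

lemma I_ratio_lower:
  assumes m: "0 < m"
  shows "I p m powr (1 + 1 / p) * (2 * m) powr (- 1 / p) / 2 \<le> I (p + 1) m"
proof -
  \<comment> \<open>The cutoff solves \<open>m * t powr p = A / 2\<close>, so values of the gap
    below t account for at most half of A.\<close>
  define A t where "A = I p m" and "t = (A / (2 * m)) powr (1 / p)"
  have A: "0 < A" unfolding A_def using m p by (intro I_pos) auto
  have t: "0 < t" using A m by (simp add: t_def)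
  have tp: "m * t powr p = A / 2" using A m p by (simp add: t_def powr_powr)
  have int: "integrable lborel (\<lambda>s. h m s powr p)" "integrable lborel (\<lambda>s. h m s powr (p + 1))"
    using m p by (auto intro!: integrable_h)
  have "A \<le> (\<integral>s. t powr p * indicator {0<..m} s + h m s powr (p + 1) / t \<partial>lborel)"
    unfolding A_def I_def
  proof (rule integral_mono)
    show "integrable lborel (\<lambda>s. t powr p * indicator {0<..m} s + h m s powr (p + 1) / t)"
      using int by (simp add: integrable_indicator_Ioc)
    show "h m s powr p \<le> t powr p * indicator {0<..m} s + h m s powr (p + 1) / t" for s
    proof (cases "s \<in> {0<..m}")
      case True
      show ?thesis
      proof (cases "h m s \<le> t")
        case True
        then have "h m s powr p \<le> t powr p" using p h_nonneg by (intro powr_mono2) auto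
        moreover have "0 \<le> h m s powr (p + 1) / t" using t by simp
        ultimately show ?thesis using \<open>s \<in> {0<..m}\<close> by simp
      next
        case False
        then have "h m s powr p * t \<le> h m s powr p * h m s" by (intro mult_left_mono) auto
        also have "\<dots> = h m s powr (p + 1)" using False t by (simp add: powr_add)
        finally have "h m s powr p \<le> h m s powr (p + 1) / t" using t by (simp add: field_simps)
        then show ?thesis by (simp add: add_increasing)
      qed
    next
      case False
      then have "h m s = 0" using h_eq_0[of m s] h_nonpos[of s m] m by force
      then show ?thesis using False by simp
    qed
  qed (use int in simp)
  also have "\<dots> = m * t powr p + I (p + 1) m / t"
    using int m by (simp add: I_def integrable_indicator_Ioc)
  finally have "A / 2 \<le> I (p + 1) m / t" using tp by linarith
  then have "A * t / 2 \<le> I (p + 1) m" using t by (simp add: field_simps)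
  moreover have "A * t = A powr (1 + 1 / p) * (2 * m) powr (- 1 / p)"
    using A m by (simp add: t_def powr_divide powr_add powr_minus field_simps)
  ultimately show ?thesis by (simp add: A_def)
qed

text \<open>Here \<open>s\<^sub>0\<close> is a free parameter: taking it large makes the leading
  coefficient small, while the last term does not depend on m and is outweighed once
  \<open>I p m\<close> is large. Beyond \<open>s\<^sub>0\<close> the gap is at most t, which trades
  one power for the factor t.\<close>

lemma I_ratio_upper:
  assumes s: "0 < s\<^sub>0" "s\<^sub>0 \<le> m"
  shows "I (p + 1) m \<le> (1 + 2 powr (p + 1)) * s\<^sub>0 powr (- 1 / p) * I p m powr (1 + 1 / p) + 2 powr (p + 1) * I (p + 1) s\<^sub>0"
proof -
  have m: "0 < m" using s by simp
  define A t where "A = I p m" and "t = (A / s\<^sub>0) powr (1 / p)"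
  define C where "C = 2 powr (p + 1)"
  have C: "0 < C" by (simp add: C_def)
  have A: "0 < A" unfolding A_def using m p by (intro I_pos) auto
  have t: "0 < t" using A s by (simp add: t_def)
  have "h m s\<^sub>0 powr p \<le> A / s\<^sub>0"
    using I_lower[of s\<^sub>0 m p] s p by (simp add: A_def field_simps)
  then have "(h m s\<^sub>0 powr p) powr (1 / p) \<le> t" unfolding t_def using p by (intro powr_mono2) auto
  then have ht: "h m s\<^sub>0 \<le> t" using p h_nonneg[of m s\<^sub>0] by (simp add: powr_powr)
  have int: "integrable lborel (\<lambda>s. h m s powr p)" "integrable lborel (\<lambda>s. h m s powr (p + 1))"
    "integrable lborel (\<lambda>s. h s\<^sub>0 s powr (p + 1))"
    using m s p by (auto intro!: integrable_h)
  have "I (p + 1) m \<le> (\<integral>s. t * h m s powr p + C * (t powr (p + 1) * indicator {0<..s\<^sub>0} s + h s\<^sub>0 s powr (p + 1)) \<partial>lborel)"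
    unfolding I_def
  proof (rule integral_mono)
    show "integrable lborel (\<lambda>s. t * h m s powr p + C * (t powr (p + 1) * indicator {0<..s\<^sub>0} s + h s\<^sub>0 s powr (p + 1)))"
      using int by (simp add: integrable_indicator_Ioc)
    fix s
    show "h m s powr (p + 1) \<le> t * h m s powr p + C * (t powr (p + 1) * indicator {0<..s\<^sub>0} s + h s\<^sub>0 s powr (p + 1))"
    proof (cases "s \<in> {0<..s\<^sub>0}")
      case True
      \<comment> \<open>Gaps add up along \<open>s\<close>, \<open>s\<^sub>0\<close>,
        \<open>m\<close>; only the part independent of \<open>m\<close> is singular at 0.\<close>
      then have "h m s = h m s\<^sub>0 + h s\<^sub>0 s"
        using g_le[of s s\<^sub>0] g_le[of s\<^sub>0 m] s by (simp add: h_def)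
      then have "h m s powr (p + 1) \<le> (t + h s\<^sub>0 s) powr (p + 1)"
        using ht p h_nonneg by (intro powr_mono2) auto
      also have "\<dots> \<le> C * (t powr (p + 1) + h s\<^sub>0 s powr (p + 1))"
        unfolding C_def using t p h_nonneg by (intro powr_add_le) auto
      finally show ?thesis using True t by (simp add: add_increasing)
    next
      case False
      have "h m s \<le> t"
        using False h_antimono[of s\<^sub>0 s m] h_nonpos[of s m] ht s t by (cases "s \<le> 0") auto
      then have "h m s powr p * h m s \<le> h m s powr p * t" by (intro mult_left_mono) auto
      moreover have "h m s powr (p + 1) = h m s powr p * h m s"
        using h_nonneg[of m s] p by (cases "h m s = 0") (auto simp: powr_add)
      moreover have "0 \<le> C * h s\<^sub>0 s powr (p + 1)" using C by simp
      ultimately show ?thesis using False by (simp add: mult.commute)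
    qed
  qed (use int in simp)
  also have "\<dots> = t * A + C * (s\<^sub>0 * t powr (p + 1) + I (p + 1) s\<^sub>0)"
    using int s by (simp add: I_def A_def integrable_indicator_Ioc)
  also have "s\<^sub>0 * t powr (p + 1) = t * A"
    using A s p t by (simp add: powr_add) (simp add: t_def powr_powr)
  also have "t * A = s\<^sub>0 powr (- 1 / p) * A powr (1 + 1 / p)"
    using A s by (simp add: t_def powr_divide powr_add powr_minus field_simps)
  finally show ?thesis by (simp add: A_def C_def algebra_simps)
qed

text \<open>\<open>I_lower\<close> at s = m / 2 bounds \<open>I p m\<close> below by a constant
  times \<open>m powr (1 - \<delta> * p)\<close>, and the exponent is positive because
  \<open>\<delta> * (p + 1) < 1\<close>.\<close>

lemma I_at_top: "filterlim (I p) at_top at_top"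
proof -
  obtain m\<^sub>0 where m0: "0 < m\<^sub>0" "\<And>m. m\<^sub>0 \<le> m \<Longrightarrow> m powr (- \<delta>) / 2 \<le> g m - g (m / 2)"
    using growth_at_top by blast
  define a where "a = 1 - \<delta> * p"
  have a: "0 < a" using \<delta> by (simp add: a_def algebra_simps)
  define C where "C = inverse (2 * 2 powr p)"
  have C: "0 < C" by (simp add: C_def)
  have "filterlim (\<lambda>m. C * exp (a * ln m)) at_top at_top"
    using a C by (intro filterlim_tendsto_pos_mult_at_top[OF tendsto_const]
        filterlim_compose[OF exp_at_top] ln_at_top)
  moreover have "eventually (\<lambda>m. C * exp (a * ln m) \<le> I p m) at_top"
    using eventually_ge_at_top[of m\<^sub>0]
  proof eventually_elim
    case (elim m)
    have m: "0 < m" using elim m0 by simp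
    have "m powr (- \<delta>) / 2 \<le> h m (m / 2)" 
    proof -
      have "g m - g (m / 2) \<le> h m (m / 2)" using m by (simp add: h_def)
      then show ?thesis using m0(2)[OF elim] by linarith
    qed
    then have "m / 2 * (m powr (- \<delta>) / 2) powr p \<le> m / 2 * h m (m / 2) powr p"
      using m p by (intro mult_left_mono powr_mono2) auto
    also have "\<dots> \<le> I p m" using m p by (intro I_lower) auto
    also have "m / 2 * (m powr (- \<delta>) / 2) powr p = C * m powr a"
      using m by (simp add: C_def a_def powr_divide powr_mult powr_powr powr_diff powr_minus field_simps)
    also have "m powr a = exp (a * ln m)" using m by (simp add: powr_def)
    finally show ?case .
  qed
  ultimately show ?thesis by (rule filterlim_at_top_mono)
qed

lemma I_ratio_surj:
  assumes \<kappa>: "0 < \<kappa>"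
  obtains m where "0 < m" "I (p + 1) m = \<kappa> * I p m powr (1 + 1 / p)"
proof -
  define \<Theta> where "\<Theta> = (\<lambda>m. I (p + 1) m / I p m powr (1 + 1 / p))"
  have Ip: "0 < I p m" if "0 < m" for m using that p by (intro I_pos) auto
  define D where "D = 1 + 2 powr (p + 1)"
  have D: "0 < D" by (simp add: D_def add_pos_pos)
  \<comment> \<open>The point at which the bound of \<open>I_ratio_lower\<close> equals \<kappa>
    exactly.\<close>
  define a where "a = (2 * \<kappa>) powr (- p) / 2"
  have a: "0 < a" using \<kappa> by (simp add: a_def)
  have \<Theta>a: "\<kappa> \<le> \<Theta> a"
  proof -
    have "(2 * a) powr (- 1 / p) / 2 = \<kappa>" using \<kappa> p by (simp add: a_def powr_powr)
    then show ?thesis using I_ratio_lower[OF a] Ip[OF a] by (simp add: \<Theta>_def field_simps)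
  qed
  \<comment> \<open>Makes the leading coefficient of \<open>I_ratio_upper\<close> equal to \<kappa>
    / 2; the other half of \<kappa> pays for the last term.\<close>
  define s\<^sub>0 where "s\<^sub>0 = (\<kappa> / (2 * D)) powr (- p)"
  have s0: "0 < s\<^sub>0" "D * s\<^sub>0 powr (- 1 / p) = \<kappa> / 2"
    using \<kappa> D p by (simp_all add: s\<^sub>0_def powr_powr)
  \<comment> \<open>Once \<open>I p b\<close> reaches Z, the last term of
    \<open>I_ratio_upper\<close> is at most
    \<open>\<kappa> / 2 * I p b powr (1 + 1 / p)\<close>.\<close>
  define Z where "Z = (2 * 2 powr (p + 1) * I (p + 1) s\<^sub>0 / \<kappa>) powr (1 / (1 + 1 / p))"
  have "eventually (\<lambda>b. Z \<le> I p b \<and> a \<le> b \<and> s\<^sub>0 \<le> b) at_top"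
    using I_at_top eventually_ge_at_top[of a] eventually_ge_at_top[of s\<^sub>0]
    by (auto simp: filterlim_at_top intro!: eventually_conj)
  then obtain b where b: "Z \<le> I p b" "a \<le> b" "s\<^sub>0 \<le> b"
    using eventually_happens by fastforce
  have \<Theta>b: "\<Theta> b \<le> \<kappa>"
  proof -
    have b0: "0 < b" using a b by simp
    have "0 < I (p + 1) s\<^sub>0" using s0 p by (intro I_pos) auto
    have "2 * 2 powr (p + 1) * I (p + 1) s\<^sub>0 / \<kappa> = Z powr (1 + 1 / p)"
    proof -
      have "1 / e * e = 1" if "0 < e" for e :: real using that by simp
      from this[of "1 + 1 / p"] have "1 / (1 + 1 / p) * (1 + 1 / p) = 1"
        using p by (simp add: add_pos_pos)
      then show ?thesis using \<open>0 < I (p + 1) s\<^sub>0\<close> \<kappa> by (simp only: Z_def powr_powr) simp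
    qed
    also have "\<dots> \<le> I p b powr (1 + 1 / p)"
      using b(1) p by (intro powr_mono2) (auto simp: Z_def)
    finally have "2 powr (p + 1) * I (p + 1) s\<^sub>0 \<le> \<kappa> / 2 * I p b powr (1 + 1 / p)"
      using \<kappa> by (simp add: field_simps)
    then have "I (p + 1) b \<le> \<kappa> * I p b powr (1 + 1 / p)"
      using I_ratio_upper[OF s0(1) b(3)] unfolding D_def[symmetric] s0(2) by (simp add: field_simps)
    then show ?thesis using Ip[OF b0] by (simp add: \<Theta>_def field_simps)
  qed
  have "continuous_on {a..b} \<Theta>"
    unfolding \<Theta>_def using a p Ip
    by (intro continuous_intros continuous_I) (auto simp: less_imp_neq[THEN not_sym])
  then obtain m where m: "a \<le> m" "\<Theta> m = \<kappa>" using IVT2'[of \<Theta> b \<kappa> a] \<Theta>a \<Theta>b b(2) by blast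
  show thesis
    using that[of m] m a Ip[of m] by (auto simp: \<Theta>_def field_simps)
qed

end

section \<open>The deformed exponential\<close>

locale deformed_log =
  fixes \<phi> :: "real \<Rightarrow> real"
  assumes mono: "strict_mono_on {0<..} \<phi>"
    and pos: "0 < s \<Longrightarrow> 0 < \<phi> s"
    and cont: "continuous_on {0<..} \<phi>"
begin

lemma DERIV_ln_phi:
  assumes "0 < t" shows "(ln_phi \<phi> has_real_derivative 1 / \<phi> t) (at t)"
proof -
  \<comment> \<open>A compact interval inside the half-line that contains the base point 1 and has t
    in its interior.\<close>
  define a b where "a = min t 1 / 2" and "b = max t 1 + 1"
  have ab: "0 < a" "a \<le> 1" "1 \<le> b" "a < t" "t < b" using assms by (auto simp: a_def b_def)
  have "continuous_on {a..b} (\<lambda>s. 1 / \<phi> s)"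
    using ab pos by (intro continuous_intros continuous_on_subset[OF cont]) (auto simp: less_imp_neq[THEN not_sym])
  then have "(ln_phi \<phi> has_vector_derivative 1 / \<phi> t) (at t within {a..b})"
    unfolding ln_phi_def[abs_def] using ab by (intro interval_integral_FTC2) auto
  then show ?thesis
    using ab by (simp add: has_real_derivative_iff_has_vector_derivative at_within_Icc_at)
qed

lemma ln_phi_less: "0 < s \<Longrightarrow> s < t \<Longrightarrow> ln_phi \<phi> s < ln_phi \<phi> t"
proof -
  assume st: "0 < s" "s < t"
  have "\<exists>y. (ln_phi \<phi> has_real_derivative y) (at x) \<and> 0 < y" if "s \<le> x" for x
    using DERIV_ln_phi[of x] pos[of x] st that by (intro exI[of _ "1 / \<phi> x"]) auto
  then show ?thesis by (intro DERIV_pos_imp_increasing[OF st(2)]) auto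
qed

lemma ln_phi_less_iff: "0 < s \<Longrightarrow> 0 < t \<Longrightarrow> ln_phi \<phi> s < ln_phi \<phi> t \<longleftrightarrow> s < t"
  using ln_phi_less[of s t] ln_phi_less[of t s] by (cases s t rule: linorder_cases) auto

lemma inj_ln_phi: "inj_on (ln_phi \<phi>) {0<..}"
  using ln_phi_less by (intro linorder_inj_onI) (auto simp: less_imp_neq)

lemma continuous_ln_phi: "continuous_on {0<..} (ln_phi \<phi>)"
  using DERIV_ln_phi by (auto intro!: continuous_at_imp_continuous_on DERIV_isCont)

lemma l_phi_less: "0 < t \<Longrightarrow> l_phi \<phi> < ereal (ln_phi \<phi> t)"
  using ln_phi_less[of "t/2" t] unfolding l_phi_def
  by (intro INF_less_iff[THEN iffD2] bexI[of _ "t/2"]) auto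

lemma less_L_phi: "0 < t \<Longrightarrow> ereal (ln_phi \<phi> t) < L_phi \<phi>"
  using ln_phi_less[of t "t + 1"] unfolding L_phi_def
  by (intro less_SUP_iff[THEN iffD2] bexI[of _ "t + 1"]) auto

lemma ln_phi_surj:
  assumes "l_phi \<phi> < ereal \<tau>" "ereal \<tau> < L_phi \<phi>"
  obtains t where "0 < t" "ln_phi \<phi> t = \<tau>"
proof -
  obtain a b where ab: "0 < a" "ln_phi \<phi> a < \<tau>" "0 < b" "\<tau> < ln_phi \<phi> b"
    using assms by (auto simp: l_phi_def L_phi_def INF_less_iff less_SUP_iff)
  then have "a < b" using ln_phi_less_iff[of a b] by linarith
  then obtain t where "a \<le> t" "ln_phi \<phi> t = \<tau>"
    using IVT'[of "ln_phi \<phi>" a \<tau> b] ab continuous_on_subset[OF continuous_ln_phi, of "{a..b}"] by fastforce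
  with ab that[of t] show thesis by simp
qed

lemma exp_phi_ln_phi:
  assumes "0 < t" shows "exp_phi \<phi> (ln_phi \<phi> t) = ennreal t"
  using l_phi_less[OF assms] less_L_phi[OF assms] the_inv_into_f_f[OF inj_ln_phi, of t] assms
  by (simp add: exp_phi_def not_le[symmetric])

lemma mono_exp_phi: "mono (exp_phi \<phi>)"
proof (rule monoI)
  fix \<tau> \<tau>' :: real assume le: "\<tau> \<le> \<tau>'"
  consider "ereal \<tau> \<le> l_phi \<phi>" | "L_phi \<phi> \<le> ereal \<tau>'" | "l_phi \<phi> < ereal \<tau>" "ereal \<tau>' < L_phi \<phi>"
    by force
  then show "exp_phi \<phi> \<tau> \<le> exp_phi \<phi> \<tau>'"
  proof cases
    case 2
    have "\<not> ereal \<tau>' \<le> l_phi \<phi>"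
      using 2 l_phi_less[of 1] less_L_phi[of 1] by auto
    then show ?thesis using 2 by (simp add: exp_phi_def)
  next
    case 3
    have "ereal \<tau> < L_phi \<phi>" "l_phi \<phi> < ereal \<tau>'"
      using 3 le by (meson ereal_less_eq(3) le_less_trans less_le_trans)+
    with 3 obtain t t' where "0 < t" "ln_phi \<phi> t = \<tau>" "0 < t'" "ln_phi \<phi> t' = \<tau>'"
      by (metis ln_phi_surj)
    moreover have "t \<le> t'" using calculation le ln_phi_less_iff[of t' t] by linarith
    ultimately show ?thesis using exp_phi_ln_phi[of t] exp_phi_ln_phi[of t'] by (simp add: ennreal_leI)
  qed (simp add: exp_phi_def)
qed

text \<open>Monotonicity across all three regimes of \<open>exp_phi\<close> makes every superlevel
  set an interval.\<close>

lemma measurable_exp_phi [measurable]: "exp_phi \<phi> \<in> borel_measurable borel"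
proof (rule borel_measurableI_greater)
  fix y
  have "is_interval {\<tau>. y < exp_phi \<phi> \<tau>}"
    unfolding is_interval_1 using monoD[OF mono_exp_phi] by (blast intro: less_le_trans)
  then show "{\<tau> \<in> space borel. y < exp_phi \<phi> \<tau>} \<in> sets borel"
    using real_interval_borel_measurable by simp
qed

text \<open>The inverse of \<open>ln_phi \<phi>\<close> at a level is the length of the set of s
  below that level. At or below \<open>l_phi \<phi>\<close> the set is empty, matching the value 0;
  since r \<ge> 0, the argument stays below \<open>L_phi \<phi>\<close> and the value infinity does
  not arise.\<close>

lemma exp_phi_superlevel:
  assumes "0 < m" "0 \<le> r"
  shows "exp_phi \<phi> (ln_phi \<phi> m - r) = emeasure lborel {s. 0 < s \<and> r < ln_phi \<phi> m - ln_phi \<phi> s}"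
proof -
  define \<tau> where "\<tau> = ln_phi \<phi> m - r"
  have "ereal \<tau> \<le> ereal (ln_phi \<phi> m)" using assms by (simp add: \<tau>_def)
  then have L: "ereal \<tau> < L_phi \<phi>" using less_L_phi[OF assms(1)] by (rule le_less_trans)
  show ?thesis
  proof (cases "ereal \<tau> \<le> l_phi \<phi>")
    case True
    have "\<tau> < ln_phi \<phi> s" if "0 < s" for s
      using le_less_trans[OF True l_phi_less[OF that]] by simp
    then have empty: "{s. 0 < s \<and> r < ln_phi \<phi> m - ln_phi \<phi> s} = {}" by (force simp: \<tau>_def)
    show ?thesis unfolding empty using True by (simp add: exp_phi_def \<tau>_def)
  next
    case False
    then have "l_phi \<phi> < ereal \<tau>" by simp
    then obtain t where t: "0 < t" "ln_phi \<phi> t = \<tau>" using L by (rule ln_phi_surj)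
    have "r < ln_phi \<phi> m - ln_phi \<phi> s \<longleftrightarrow> s < t" if "0 < s" for s
      using t(2) ln_phi_less_iff[OF that t(1)] by (auto simp: \<tau>_def)
    then have interval: "{s. 0 < s \<and> r < ln_phi \<phi> m - ln_phi \<phi> s} = {0<..<t}" by auto
    show ?thesis unfolding interval using exp_phi_ln_phi[OF t(1)] t by (simp add: \<tau>_def)
  qed
qed

end

section \<open>Layer cake integration of radial functions\<close>

definition ball_moment :: "'a::euclidean_space itself \<Rightarrow> nat \<Rightarrow> real" where
  "ball_moment _ k = (\<integral>x. indicator (ball 0 1) (x :: 'a) * norm x ^ k \<partial>lborel)"

lemma integrable_ball_moment: "integrable lborel (\<lambda>x :: 'a::euclidean_space. indicator (ball 0 1) x * norm x ^ k)"
proof (rule Bochner_Integration.integrable_bound)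
  have [measurable]: "ball (0 :: 'a) 1 \<in> sets borel" by simp
  show "(\<lambda>x :: 'a. indicator (ball 0 1) x * norm x ^ k) \<in> borel_measurable lborel" by measurable
  show "integrable lborel (indicator (ball 0 1) :: 'a \<Rightarrow> real)"
    using emeasure_lborel_ball_finite[of "0 :: 'a" 1] by (intro integrable_real_indicator) auto
  show "AE x :: 'a in lborel. norm (indicator (ball 0 1) x * norm x ^ k) \<le> norm (indicator (ball 0 1) x :: real)"
    by (auto simp: indicator_def power_le_one)
qed

lemma ball_moment_pos: "0 < ball_moment TYPE('a::euclidean_space) k"
proof -
  have "0 \<le> ball_moment TYPE('a) k" unfolding ball_moment_def by (rule Bochner_Integration.integral_nonneg) simp
  moreover have "ball_moment TYPE('a) k \<noteq> 0"
  proof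
    assume "ball_moment TYPE('a) k = 0"
    then have "AE x :: 'a in lborel. indicator (ball 0 1) x * norm x ^ k = (0::real)"
      unfolding ball_moment_def using integral_nonneg_eq_0_iff_AE[OF integrable_ball_moment] by auto
    \<comment> \<open>The origin is removed separately, since the power of the norm vanishes there
      for k > 0.\<close>
    then have "AE x :: 'a in lborel. x \<notin> ball 0 1"
      using AE_lborel_singleton[of "0 :: 'a"] by eventually_elim (auto simp: indicator_def split: if_splits)
    then have "ball (0 :: 'a) 1 \<in> null_sets lborel" by (subst AE_iff_null_sets) auto
    then have "measure lborel (ball (0 :: 'a) 1) = 0" by (simp add: measure_eq_0_null_sets)
    moreover have "0 < measure lborel (ball (0 :: 'a) 1)" by (rule content_ball_pos) simp
    ultimately show False by simp
  qed
  ultimately show ?thesis by simp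
qed

text \<open>Dilation by R contributes \<open>R ^ DIM('a)\<close> from the measure and
  \<open>R ^ k\<close> from the integrand; R = 0 is apart because the dilation degenerates.\<close>

lemma nn_integral_norm_power_ball:
  assumes "0 \<le> R"
  shows "(\<integral>\<^sup>+x. indicator (ball 0 R) x * ennreal (norm (x :: 'a::euclidean_space) ^ k) \<partial>lborel) =
    ennreal (ball_moment TYPE('a) k) * ennreal (R ^ (DIM('a) + k))"
proof (cases "R = 0")
  case False
  with assms have R: "0 < R" by simp
  define f where "f = (\<lambda>x :: 'a. indicator (ball 0 R) x * ennreal (norm x ^ k))"
  have [measurable]: "ball (0 :: 'a) R \<in> sets borel" by simp
  have [measurable]: "f \<in> borel_measurable borel" unfolding f_def by measurable
  have "(\<integral>\<^sup>+x. f x \<partial>lborel) =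
      (\<integral>\<^sup>+x. f x \<partial>density (distr lborel borel (\<lambda>x :: 'a. 0 + R *\<^sub>R x)) (\<lambda>_. ennreal (\<bar>R\<bar> ^ DIM('a))))"
    using lborel_affine[of R "0 :: 'a"] False by simp
  also have "\<dots> = (\<integral>\<^sup>+x. ennreal (\<bar>R\<bar> ^ DIM('a)) * f x \<partial>distr lborel borel (\<lambda>x :: 'a. 0 + R *\<^sub>R x))"
    by (rule nn_integral_density) measurable
  also have "\<dots> = (\<integral>\<^sup>+x. ennreal (\<bar>R\<bar> ^ DIM('a)) * f (0 + R *\<^sub>R x) \<partial>lborel)"
    by (rule nn_integral_distr) measurable
  also have "\<dots> = (\<integral>\<^sup>+x. ennreal (R ^ (DIM('a) + k)) * ennreal (indicator (ball 0 1) (x :: 'a) * norm x ^ k) \<partial>lborel)"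
    using R by (intro nn_integral_cong)
      (auto simp: f_def indicator_def power_mult_distrib power_add ennreal_mult mult_ac)
  also have "\<dots> = ennreal (R ^ (DIM('a) + k)) * ennreal (ball_moment TYPE('a) k)"
    by (subst nn_integral_cmult) (use integrable_ball_moment[where 'a = 'a, of k, THEN borel_measurable_integrable] in
        \<open>auto simp: ball_moment_def nn_integral_eq_integral[OF integrable_ball_moment]\<close>)
  finally show ?thesis by (simp add: f_def mult.commute)
qed simp

locale deformed_log_gap = deformed_log +
  fixes p \<delta> :: real
  assumes gap: "profile_gap (ln_phi \<phi>) p \<delta>"
begin

sublocale profile_gap "ln_phi \<phi>" p \<delta> by (rule gap)

text \<open>Layer cake: the superlevel sets of \<open>exp_phi\<close> of a quadratic are balls.\<close>

lemma nn_integral_exp_phi_quadratic: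
  assumes m: "0 < m" and c: "0 < c" and q: "q = (real DIM('a) + real k) / 2" "q \<le> p + 1"
  shows "(\<integral>\<^sup>+x. ennreal (norm (x :: 'a::euclidean_space) ^ k) * exp_phi \<phi> (ln_phi \<phi> m - c * (norm x)\<^sup>2) \<partial>lborel) =
    ennreal (ball_moment TYPE('a) k * c powr (- q) * I q m)"
proof -
  have q0: "0 < q" unfolding q(1) using DIM_positive[where 'a='a] by (simp add: add_pos_nonneg)
  have exp: "exp_phi \<phi> (ln_phi \<phi> m - c * (norm x)\<^sup>2) = (\<integral>\<^sup>+s. indicator {s. c * (norm x)\<^sup>2 < h m s} s \<partial>lborel)" for x :: 'a
  proof -
    have nn: "0 \<le> c * (norm x)\<^sup>2" using c by simp
    then have "{s. 0 < s \<and> c * (norm x)\<^sup>2 < ln_phi \<phi> m - ln_phi \<phi> s} = {s. c * (norm x)\<^sup>2 < h m s}"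
      by (auto simp: h_def less_max_iff_disj)
    then show ?thesis using exp_phi_superlevel[OF m nn] by simp
  qed
  \<comment> \<open>For fixed s the superlevel set is a ball of radius
    \<open>sqrt (h m s / c)\<close>; its power \<open>DIM('a) + k\<close> is the power q of
    \<open>h m s / c\<close>.\<close>
  have inner: "(\<integral>\<^sup>+x. ennreal (norm (x :: 'a) ^ k) * indicator {s. c * (norm x)\<^sup>2 < h m s} s \<partial>lborel) =
      ennreal (ball_moment TYPE('a) k * c powr (- q)) * ennreal (h m s powr q)" for s
  proof -
    define R where "R = sqrt (h m s / c)"
    have R: "0 \<le> R" "R\<^sup>2 = h m s / c" using h_nonneg[of m s] c by (simp_all add: R_def)
    have "c * (norm x)\<^sup>2 < h m s \<longleftrightarrow> norm x < R" for x :: 'a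
    proof -
      have "c * (norm x)\<^sup>2 < h m s \<longleftrightarrow> (norm x)\<^sup>2 < R\<^sup>2" using c by (simp add: R field_simps)
      also have "\<dots> \<longleftrightarrow> norm x < R" using R(1) by (auto intro: power2_less_imp_less power_strict_mono)
      finally show ?thesis .
    qed
    then have "(\<integral>\<^sup>+x. ennreal (norm (x :: 'a) ^ k) * indicator {s. c * (norm x)\<^sup>2 < h m s} s \<partial>lborel) =
        (\<integral>\<^sup>+x. indicator (ball 0 R) x * ennreal (norm (x :: 'a) ^ k) \<partial>lborel)"
      by (intro nn_integral_cong) (auto simp: indicator_def)
    also have "\<dots> = ennreal (ball_moment TYPE('a) k) * ennreal (R ^ (DIM('a) + k))"
      by (rule nn_integral_norm_power_ball[OF R(1)])
    also have "R ^ (DIM('a) + k) = c powr (- q) * h m s powr q"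
    proof (cases "h m s = 0")
      case True
      then have "R = 0" by (simp add: R_def)
      then show ?thesis using True q0 by simp
    next
      case False
      then have "0 < h m s" using h_nonneg[of m s] by simp
      then have "0 < R" "R = (h m s / c) powr (1 / 2)" using c by (simp_all add: R_def powr_half_sqrt)
      then have "R ^ (DIM('a) + k) = R powr real (DIM('a) + k)"
        by (intro powr_realpow[symmetric])
      also have "\<dots> = (h m s / c) powr q"
        unfolding \<open>R = (h m s / c) powr (1 / 2)\<close> by (simp add: powr_powr q(1))
      also have "\<dots> = c powr (- q) * h m s powr q"
        using \<open>0 < h m s\<close> c by (simp add: powr_divide powr_minus field_simps)
      finally show ?thesis .
    qed
    finally show ?thesis
      using ball_moment_pos[where 'a='a, of k] by (simp add: ennreal_mult' mult.assoc less_imp_le)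
  qed
  have meas: "(\<lambda>(x :: 'a, s). ennreal (norm x ^ k) * indicator {s. c * (norm x)\<^sup>2 < h m s} s)
      \<in> borel_measurable (lborel \<Otimes>\<^sub>M lborel)"
    unfolding indicator_def by measurable
  have "(\<integral>\<^sup>+x. ennreal (norm (x :: 'a) ^ k) * exp_phi \<phi> (ln_phi \<phi> m - c * (norm x)\<^sup>2) \<partial>lborel) =
      (\<integral>\<^sup>+x. \<integral>\<^sup>+s. ennreal (norm (x :: 'a) ^ k) * indicator {s. c * (norm x)\<^sup>2 < h m s} s \<partial>lborel \<partial>lborel)"
    by (subst nn_integral_cmult) (auto simp: exp)
  also have "\<dots> = (\<integral>\<^sup>+s. \<integral>\<^sup>+x. ennreal (norm (x :: 'a) ^ k) * indicator {s. c * (norm x)\<^sup>2 < h m s} s \<partial>lborel \<partial>lborel)"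
    using lborel_pair.Fubini'[OF meas] by simp
  also have "\<dots> = ennreal (ball_moment TYPE('a) k * c powr (- q)) * (\<integral>\<^sup>+s. ennreal (h m s powr q) \<partial>lborel)"
    unfolding inner by (rule nn_integral_cmult) simp
  also have "\<dots> = ennreal (ball_moment TYPE('a) k * c powr (- q) * I q m)"
    using nn_integral_h[OF m q0 q(2)] ball_moment_pos[where 'a='a, of k] I_pos[OF m q0 q(2)]
    by (simp add: ennreal_mult less_imp_le)
  finally show ?thesis .
qed

text \<open>With k = 0 and k = 2 the exponent q is p and p + 1, so the conditions read
  \<open>a * c powr (- p) * I p m = 1\<close> and
  \<open>b * c powr (- (p + 1)) * I (p + 1) m = d\<close>. The first determines \<open>c\<close>;
  inserting it in the second gives the ratio \<kappa> that \<open>I_ratio_surj\<close>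
  attains.\<close>

lemma exists_normalising_constants:
  assumes p_def: "p = real CARD('n) / 2"
  obtains m c where "0 < m" "0 < c"
    "(\<integral>\<^sup>+x. exp_phi \<phi> (ln_phi \<phi> m - c * (norm (x :: real^'n))\<^sup>2) \<partial>lborel) = 1"
    "(\<integral>\<^sup>+x. ennreal ((norm (x :: real^'n))\<^sup>2) * exp_phi \<phi> (ln_phi \<phi> m - c * (norm x)\<^sup>2) \<partial>lborel) = of_nat CARD('n)"
proof -
  define a b where "a = ball_moment TYPE(real^'n) 0" and "b = ball_moment TYPE(real^'n) 2"
  have ab: "0 < a" "0 < b" by (simp_all add: a_def b_def ball_moment_pos)
  define \<kappa> where "\<kappa> = real CARD('n) * a powr (1 + 1 / p) / b"
  have "0 < \<kappa>" using ab by (simp add: \<kappa>_def)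
  then obtain m where m: "0 < m" "I (p + 1) m = \<kappa> * I p m powr (1 + 1 / p)" by (rule I_ratio_surj)
  have Ip: "0 < I p m" using m p by (intro I_pos) auto
  define c where "c = (a * I p m) powr (1 / p)"
  have c: "0 < c" using ab Ip by (simp add: c_def)
  have cp: "c powr (- p) = inverse (a * I p m)"
    using p ab Ip by (simp add: c_def powr_powr powr_minus)
  show thesis
  proof (rule that[OF m(1) c])
    have "a * c powr (- p) * I p m = 1" using ab Ip by (simp add: cp field_simps)
    then show "(\<integral>\<^sup>+x. exp_phi \<phi> (ln_phi \<phi> m - c * (norm (x :: real^'n))\<^sup>2) \<partial>lborel) = 1"
      using nn_integral_exp_phi_quadratic[OF m(1) c, of p 0, where 'a = "real^'n"]
      by (simp add: p_def a_def[symmetric])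
    define X where "X = 1 + 1 / p"
    have "1 / p * - (p + 1) = - X" using p by (simp add: X_def field_simps)
    then have "c powr (- (p + 1)) = (a * I p m) powr (- X)"
      by (simp only: c_def powr_powr)
    then have "b * c powr (- (p + 1)) * I (p + 1) m = real CARD('n)"
      unfolding m(2) \<kappa>_def X_def[symmetric] using ab Ip by (simp add: powr_minus powr_mult field_simps)
    then show "(\<integral>\<^sup>+x. ennreal ((norm (x :: real^'n))\<^sup>2) * exp_phi \<phi> (ln_phi \<phi> m - c * (norm x)\<^sup>2) \<partial>lborel) = of_nat CARD('n)"
      using nn_integral_exp_phi_quadratic[OF m(1) c, of "p + 1" 2, where 'a = "real^'n"]
      by (simp add: p_def b_def[symmetric] add_divide_distrib ennreal_of_nat_eq_real_of_nat)
  qed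
qed

end

section \<open>Normalising constants and the class of admissible functions\<close>

text \<open>Each infimum below a yields an admissible exponent below a, and enlarging an exponent
  weakens both bounds: near 0 powers are compared for s < 1, at infinity for s \<ge> 1. So one
  \<delta> serves both ends, and including a / 2 in the maximum makes it positive.\<close>

lemma class_O_exponent:
  assumes "\<phi> \<in> class_O a" "0 < a"
  obtains \<delta> C s\<^sub>0 m\<^sub>0 where "0 < \<delta>" "\<delta> < a" "0 < C" "0 < s\<^sub>0"
    "\<And>s. 0 < s \<Longrightarrow> s < s\<^sub>0 \<Longrightarrow> 1 / \<phi> s \<le> C * s powr (- \<delta> - 1)"
    "1 \<le> m\<^sub>0" "\<And>s. m\<^sub>0 \<le> s \<Longrightarrow> \<phi> s \<le> s powr (1 + \<delta>)"
proof -
  have pos: "0 < \<phi> s" if "0 < s" for s using assms that by (auto simp: class_O_def)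
  have "delta_low \<phi> < ereal a" "delta_up \<phi> < ereal a"
    using assms by (auto simp: class_O_def)
  then obtain \<delta>\<^sub>1 \<delta>\<^sub>2 l where
    d1: "\<delta>\<^sub>1 < a" "((\<lambda>s. s powr (1 + \<delta>\<^sub>1) / \<phi> s) \<longlongrightarrow> l) (at_right 0)" and
    d2: "\<delta>\<^sub>2 < a" "filterlim (\<lambda>s. s powr (1 + \<delta>\<^sub>2) / \<phi> s) at_top at_top"
    unfolding delta_low_def delta_up_def Inf_less_iff by auto
  define \<delta> where "\<delta> = max (a / 2) (max \<delta>\<^sub>1 \<delta>\<^sub>2)"
  have \<delta>: "0 < \<delta>" "\<delta> < a" "\<delta>\<^sub>1 \<le> \<delta>" "\<delta>\<^sub>2 \<le> \<delta>" using assms d1 d2 by (auto simp: \<delta>_def)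
  define C where "C = \<bar>l\<bar> + 1"
  have C: "0 < C" "l < C" by (auto simp: C_def)
  have "eventually (\<lambda>s. s powr (1 + \<delta>\<^sub>1) / \<phi> s < C) (at_right 0)"
    using d1(2) C(2) by (rule order_tendstoD)
  then obtain s\<^sub>0 where s0: "0 < s\<^sub>0" "\<And>s. 0 < s \<Longrightarrow> s < s\<^sub>0 \<Longrightarrow> s powr (1 + \<delta>\<^sub>1) / \<phi> s < C"
    unfolding eventually_at_right_field by auto
  have low: "1 / \<phi> s \<le> C * s powr (- \<delta> - 1)" if s: "0 < s" "s < min s\<^sub>0 1" for s
  proof -
    have "1 / \<phi> s = s powr (1 + \<delta>\<^sub>1) / \<phi> s * s powr (- 1 - \<delta>\<^sub>1)"
      using s by (simp add: powr_add[symmetric])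
    also have "\<dots> \<le> C * s powr (- 1 - \<delta>\<^sub>1)"
      using s0(2)[of s] s by (intro mult_right_mono) auto
    also have "\<dots> \<le> C * s powr (- \<delta> - 1)"
      using s \<delta> C by (intro mult_left_mono powr_mono') auto
    finally show ?thesis .
  qed
  have "eventually (\<lambda>s. 1 \<le> s powr (1 + \<delta>\<^sub>2) / \<phi> s) at_top"
    using d2(2) by (simp add: filterlim_at_top)
  then obtain m\<^sub>0 where m0: "\<And>s. m\<^sub>0 \<le> s \<Longrightarrow> 1 \<le> s powr (1 + \<delta>\<^sub>2) / \<phi> s"
    unfolding eventually_at_top_linorder by auto
  have up: "\<phi> s \<le> s powr (1 + \<delta>)" if s: "max m\<^sub>0 1 \<le> s" for s
  proof -
    have "\<phi> s \<le> s powr (1 + \<delta>\<^sub>2)" using m0[of s] s pos[of s] by (simp add: field_simps)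
    also have "\<dots> \<le> s powr (1 + \<delta>)" using s \<delta> by (intro powr_mono) auto
    finally show ?thesis .
  qed
  show thesis
    by (rule that[of \<delta> C "min s\<^sub>0 1" "max m\<^sub>0 1", OF \<delta>(1,2) C(1) _ low _ up]) (use s0 in auto)
qed

context deformed_log
begin

lemma ln_phi_gap_at_0:
  assumes \<delta>: "0 < \<delta>" and C: "0 < C" and s0: "0 < s\<^sub>0"
    and low: "\<And>s. 0 < s \<Longrightarrow> s < s\<^sub>0 \<Longrightarrow> 1 / \<phi> s \<le> C * s powr (- \<delta> - 1)" and m: "0 < m"
  shows "\<exists>K\<ge>0. \<forall>s\<in>{0<..m}. ln_phi \<phi> m - ln_phi \<phi> s \<le> K * s powr (- \<delta>)"
proof -
  define a where "a = s\<^sub>0 / 2"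
  have a: "0 < a" "a < s\<^sub>0" using s0 by (auto simp: a_def)
  have near: "ln_phi \<phi> a - ln_phi \<phi> s \<le> C / \<delta> * s powr (- \<delta>)" if s: "0 < s" "s \<le> a" for s
  proof -
    \<comment> \<open>The bound on \<open>1 / \<phi>\<close> in integrated form: the power term has
      derivative \<open>- C * x powr (- \<delta> - 1)\<close>, which outweighs the growth of
      \<open>ln_phi \<phi>\<close>.\<close>
    have "ln_phi \<phi> a + C / \<delta> * a powr (- \<delta>) \<le> ln_phi \<phi> s + C / \<delta> * s powr (- \<delta>)"
    proof (rule DERIV_nonpos_imp_nonincreasing[OF s(2)])
      fix x assume x: "s \<le> x" "x \<le> a"
      then have x0: "0 < x" using s by simp
      have "((\<lambda>x. ln_phi \<phi> x + C / \<delta> * x powr (- \<delta>)) has_real_derivative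
          1 / \<phi> x + C / \<delta> * (- \<delta> * x powr (- \<delta> - 1))) (at x)"
        using x0 by (intro DERIV_add DERIV_ln_phi DERIV_cmult has_real_derivative_powr)
      moreover have "1 / \<phi> x + C / \<delta> * (- \<delta> * x powr (- \<delta> - 1)) \<le> 0"
        using low[of x] x x0 a \<delta> by (simp add: algebra_simps)
      ultimately show "\<exists>y. ((\<lambda>x. ln_phi \<phi> x + C / \<delta> * x powr (- \<delta>)) has_real_derivative y) (at x) \<and> y \<le> 0"
        by blast
    qed
    moreover have "0 \<le> C / \<delta> * a powr (- \<delta>)" using C \<delta> by simp
    ultimately show ?thesis by simp
  qed
  define D where "D = \<bar>ln_phi \<phi> m - ln_phi \<phi> a\<bar>"
  define K where "K = C / \<delta> + D * (a powr \<delta> + m powr \<delta>)"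
  have "ln_phi \<phi> m - ln_phi \<phi> s \<le> K * s powr (- \<delta>)" if s: "s \<in> {0<..m}" for s
  proof -
    have "ln_phi \<phi> m - ln_phi \<phi> s \<le> C / \<delta> * s powr (- \<delta>) + D"
    proof (cases "s \<le> a")
      case True
      then show ?thesis using near[of s] s by (simp add: D_def)
    next
      case False
      then have "ln_phi \<phi> a < ln_phi \<phi> s" using a by (intro ln_phi_less) auto
      then show ?thesis using C \<delta> by (simp add: D_def add_increasing)
    qed
    \<comment> \<open>A constant is absorbed by the power, since \<open>s powr (- \<delta>)\<close>
      is at least \<open>m powr (- \<delta>)\<close> on (0, m].\<close>
    also have "D \<le> D * (a powr \<delta> + m powr \<delta>) * s powr (- \<delta>)"
    proof -
      have "s powr \<delta> \<le> m powr \<delta>" using s \<delta> by (intro powr_mono2) auto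
      then have "1 \<le> (a powr \<delta> + m powr \<delta>) * s powr (- \<delta>)"
        using s by (simp add: powr_minus field_simps add_increasing)
      then have "D * 1 \<le> D * ((a powr \<delta> + m powr \<delta>) * s powr (- \<delta>))"
        by (intro mult_left_mono) (auto simp: D_def)
      then show ?thesis by (simp add: mult.assoc)
    qed
    finally show ?thesis by (simp add: K_def algebra_simps)
  qed
  moreover have "0 \<le> K" using C \<delta> by (simp add: K_def D_def)
  ultimately show ?thesis by blast
qed

text \<open>Monotonicity of \<phi> carries the growth bound from m to the mean value point z, which
  may itself lie below \<open>m\<^sub>0\<close>.\<close>

lemma ln_phi_gap_at_top:
  assumes m0: "1 \<le> m\<^sub>0" and up: "\<And>s. m\<^sub>0 \<le> s \<Longrightarrow> \<phi> s \<le> s powr (1 + \<delta>)" and m: "m\<^sub>0 \<le> m"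
  shows "m powr (- \<delta>) / 2 \<le> ln_phi \<phi> m - ln_phi \<phi> (m / 2)"
proof -
  have m': "0 < m" using m0 m by simp
  obtain z where z: "m / 2 < z" "z < m" "ln_phi \<phi> m - ln_phi \<phi> (m / 2) = (m - m / 2) * (1 / \<phi> z)"
    using MVT2[of "m / 2" m "ln_phi \<phi>" "\<lambda>x. 1 / \<phi> x"] m' DERIV_ln_phi by auto
  have z0: "0 < z" using z m' by simp
  have "\<phi> z \<le> \<phi> m"
    using strict_mono_onD[OF mono, of z m] z z0 m' by simp
  also have "\<dots> \<le> m powr (1 + \<delta>)" by (rule up[OF m])
  finally have "1 / m powr (1 + \<delta>) \<le> 1 / \<phi> z" using pos[OF z0] m' by (intro divide_left_mono) auto
  then have "(m - m / 2) * (1 / m powr (1 + \<delta>)) \<le> (m - m / 2) * (1 / \<phi> z)"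
    using m' by (intro mult_left_mono) auto
  moreover have "(m - m / 2) * (1 / m powr (1 + \<delta>)) = m powr (- \<delta>) / 2"
    using m' by (simp add: powr_add powr_minus field_simps)
  ultimately show ?thesis using z(3) by simp
qed

end

text \<open>Exhibiting one pair of constants transfers \<open>phi_constants\<close> to the chosen
  pair, which may be a different one; the profile \<psi> is built from the chosen pair and inherits
  its moments from that specification.\<close>

lemma G_phi_location_scatter:
  fixes \<phi> :: "real \<Rightarrow> real"
  assumes \<phi>: "\<phi> \<in> class_O (2 / (real CARD('n::finite) + 2))"
  obtains \<psi> where "location_scatter_family (elliptic \<psi> :: real^'n \<Rightarrow> real^'n^'n \<Rightarrow> (real^'n) measure)"
    "(G_phi \<phi> :: (real^'n) measure set) = {elliptic \<psi> v V | v V. V \<in> SPD}"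
proof -
  interpret deformed_log \<phi>
    using \<phi> by unfold_locales (auto simp: class_O_def)
  define p where "p = real CARD('n) / 2"
  have p: "0 < p" by (simp add: p_def)
  have a: "2 / (real CARD('n) + 2) = 1 / (p + 1)" by (simp add: p_def field_simps)
  obtain \<delta> C s\<^sub>0 m\<^sub>0 where \<delta>: "0 < \<delta>" "\<delta> < 1 / (p + 1)" and C: "0 < C" "0 < s\<^sub>0"
    "\<And>s. 0 < s \<Longrightarrow> s < s\<^sub>0 \<Longrightarrow> 1 / \<phi> s \<le> C * s powr (- \<delta> - 1)"
    and m0: "1 \<le> m\<^sub>0" "\<And>s. m\<^sub>0 \<le> s \<Longrightarrow> \<phi> s \<le> s powr (1 + \<delta>)"
    using class_O_exponent[OF \<phi>[unfolded a]] p by (metis add_pos_pos zero_less_divide_1_iff zero_less_one)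
  have "profile_gap (ln_phi \<phi>) p \<delta>"
  proof
    show "\<delta> * (p + 1) < 1" using \<delta>(2) p by (simp add: field_simps)
    show "\<exists>m\<^sub>0>0. \<forall>m\<ge>m\<^sub>0. m powr (- \<delta>) / 2 \<le> ln_phi \<phi> m - ln_phi \<phi> (m / 2)"
      using ln_phi_gap_at_top[OF m0] m0(1) by (intro exI[of _ m\<^sub>0]) auto
  qed (use ln_phi_less continuous_ln_phi p \<delta> ln_phi_gap_at_0[OF \<delta>(1) C] in auto)
  then interpret deformed_log_gap \<phi> p \<delta>
    by (intro deformed_log_gap.intro deformed_log_gap_axioms.intro deformed_log_axioms)
  obtain m c where m: "0 < m" and c: "0 < c" and
    mass: "(\<integral>\<^sup>+x. exp_phi \<phi> (ln_phi \<phi> m - c * (norm (x :: real^'n))\<^sup>2) \<partial>lborel) = 1" and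
    second: "(\<integral>\<^sup>+x. ennreal ((norm (x :: real^'n))\<^sup>2) * exp_phi \<phi> (ln_phi \<phi> m - c * (norm x)\<^sup>2) \<partial>lborel) = of_nat CARD('n)"
    by (rule exists_normalising_constants[OF p_def])
  have density: "density lborel (g_density \<phi> l c v V) = elliptic (\<lambda>r. exp_phi \<phi> (l - c * r)) v V"
    for l c and v :: "real^'n" and V
    by (simp add: elliptic_def g_density_def[abs_def])
  have profile: "(\<lambda>r. exp_phi \<phi> (l - c * r)) \<in> borel_measurable borel" for l c by measurable
  have "g_density \<phi> (ln_phi \<phi> m) c v V \<in> borel_measurable borel" for v :: "real^'n" and V
    unfolding g_density_def[abs_def] by measurable
  then have "phi_constants TYPE('n) \<phi> (ln_phi \<phi> m) c"
    unfolding phi_constants_def density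
    using l_phi_less[OF m] less_L_phi[OF m] c elliptic_moments[OF profile mass second] by blast
  then have "phi_constants TYPE('n) \<phi> (fst (ln_phi \<phi> m, c)) (snd (ln_phi \<phi> m, c))" by simp
  then have const: "phi_constants TYPE('n) \<phi> (fst (the_phi_constants TYPE('n) \<phi>)) (snd (the_phi_constants TYPE('n) \<phi>))"
    unfolding the_phi_constants_def by (rule someI)
  define \<psi> where "\<psi> = (\<lambda>r. exp_phi \<phi> (fst (the_phi_constants TYPE('n) \<phi>) - snd (the_phi_constants TYPE('n) \<phi>) * r))"
  show thesis
  proof (rule that)
    show "location_scatter_family (elliptic \<psi> :: real^'n \<Rightarrow> real^'n^'n \<Rightarrow> (real^'n) measure)"
      using const profile unfolding phi_constants_def density \<psi>_def
      by (intro location_scatter_elliptic) auto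
    show "(G_phi \<phi> :: (real^'n) measure set) = {elliptic \<psi> v V | v V. V \<in> SPD}"
      by (simp add: G_phi_def g_phi_def density \<psi>_def)
  qed
qed

theorem proposition4p3:
  fixes \<phi> :: "real \<Rightarrow> real"
  assumes "2 \<le> CARD('n::finite)"
    and "\<phi> \<in> class_O (2 / (real CARD('n) + 2))"
  shows "W2_convex (G_phi \<phi> :: (real^'n) measure set) \<and>
         W2_isometric (G_phi \<phi> :: (real^'n) measure set) gaussians"
proof -
  obtain \<psi> where F: "location_scatter_family (elliptic \<psi> :: real^'n \<Rightarrow> real^'n^'n \<Rightarrow> (real^'n) measure)"
    and G: "(G_phi \<phi> :: (real^'n) measure set) = {elliptic \<psi> v V | v V. V \<in> SPD}"
    by (rule G_phi_location_scatter[OF assms(2)])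
  show ?thesis
    unfolding G gaussians_eq
    using location_scatter_family.W2_convex_family[OF F] W2_isometric_families[OF F location_scatter_gaussian]
    by blast
qed

end
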